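(* Let $x_1,\ldots,x_n\in\mathbb{Z}^k$ be such that the coordinates of each $x_i$ have greatest common divisor $1$, and assume $\det(x_{i_1}\cdots x_{i_k})>0$ for all $1\le i_1<\cdots<i_k\le n$. Then there exist $\ell\ge n$, vectors $y_1,\ldots,y_\ell\in\mathbb{Z}^k$, and indices $s_1<\cdots<s_n$ in $\{1,\ldots,\ell\}$ such that: (a) $y_{s_r}=x_r$ for all $r=1,\ldots,n$; (b) $\det(y_{j_1}\cdots y_{j_k})>0$ for all $1\le j_1<\cdots<j_k\le \ell$; (c) for every $i=1,\ldots,\ell$, $\det(y_{[i,i+1,\ldots,i+k-1]})=1$, where $y_{[i,i+1,\ldots,i+k-1]}$ denotes the $k\times k$ matrix whose columns are $y_i,y_{i+1},\ldots,y_{i+k-1}$, the indices being reduced modulo $\ell$ into $\{1,\ldots,\ell\}$ and the columns sorted in increasing order of the reduced indices.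
   Context: $\det(v_1\cdots v_k)$ denotes the determinant of the $k\times k$ integer matrix with columns $v_1,\ldots,v_k$ in the given order.
   Formalization: The formal theorem adds the assumption k ≤ n; for n < k the determinant condition is vacuous and the claim can fail (e.g. k = 3, n = 2, x_1 = x_2 = e_1). Linearly independent x_i with n < k are covered after completing them to k vectors of positive determinant. *)

theory Defs
  imports "Jordan_Normal_Form.Determinant"
begin

text \<open>Families of vectors are functions on \<^typ>\<open>nat\<close>, of which only the values at
  \<open>1, \<dots>, n\<close> matter (indices are 1-based).\<close>

definition col_det :: "nat \<Rightarrow> (nat \<Rightarrow> int vec) \<Rightarrow> nat list \<Rightarrow> int" where
  "col_det k v js = det (mat_of_cols k (map v js))"

definition incr_seqs :: "nat \<Rightarrow> nat \<Rightarrow> nat list set" where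
  "incr_seqs k n = {js. length js = k \<and> sorted_wrt (<) js \<and> set js \<subseteq> {1..n}}"

definition reduce_index :: "nat \<Rightarrow> nat \<Rightarrow> nat" where
  "reduce_index l m = (m - 1) mod l + 1"

text \<open>The indices \<open>i, i + 1, \<dots>, i + k - 1\<close> reduced modulo \<open>l\<close> into \<open>{1, \<dots>, l}\<close> and
  sorted increasingly; they are pairwise distinct as soon as \<open>k \<le> l\<close>.\<close>

definition cyclic_window :: "nat \<Rightarrow> nat \<Rightarrow> nat \<Rightarrow> nat list" where
  "cyclic_window k l i = sort (map (reduce_index l) [i..<i + k])"

end

theory Submission
  imports Defs "HOL-Library.Sublist"
begin

text \<open>
  Put \<open>x_{i+n} = (-1)^{k-1} x_i\<close>; positivity is then invariant under rotation of the sequence.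
  The gap between two neighbours \<open>v\<close>, \<open>h\<close> is filled by induction on \<open>k\<close>: modulo \<open>v\<close> the other
  vectors form a positive configuration of rank \<open>k - 1\<close>, whose gap is filled first, and the new
  vectors are lifted to \<open>q_j = - z_j + N_j v\<close>, the integers \<open>N_j\<close> being chosen from the last to the
  first such that each new window has determinant 1. By the Pluecker relations this one
  determinant controls the sign of all the others. The induction needs \<open>v\<close>, \<open>h\<close> to span
  a primitive sublattice; otherwise an intermediate vector is inserted first (for \<open>k = 2\<close> this is the
  Farey descent). Starting from a unimodular basis \<open>Y\<close> placed after \<open>x_n\<close>, all the gaps are filled in
  turn, and the last one is closed up so as to end in the flag of \<open>Y\<close>.

  To avoid changes of basis, all vectors stay in rank \<open>k\<close>: a list \<open>t\<close> of vectors being factored out is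
  appended to every determinant. Vectors are functions of which only the first \<open>k\<close> values matter.
\<close>

section \<open>Determinants of lists of vectors\<close>

definition vdet :: "(nat \<Rightarrow> int) list \<Rightarrow> int" where
  "vdet L = det (mat (length L) (length L) (\<lambda>(i, j). (L ! j) i))"

text \<open>The cofactors along a column do not see that column, so they may be computed with the
  zero vector in its place. Linearity of \<open>vdet\<close> in each entry is read off from this
  formula.\<close>

lemma vdet_expansion:
  "\<exists>c. \<forall>x. vdet (A @ x # B) = (\<Sum>i<length (A @ x # B). x i * c i)"
proof -
  define n where "n = length A + Suc (length B)"
  define M where "M x = mat n n (\<lambda>(i, j). ((A @ x # B) ! j) i)" for x :: "nat \<Rightarrow> int"
  have "vdet (A @ x # B) = (\<Sum>i<length (A @ x # B). x i * cofactor (M (\<lambda>_. 0)) i (length A))" for x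
  proof -
    have "vdet (A @ x # B) = det (M x)"
      by (simp add: vdet_def M_def n_def)
    also have "\<dots> = (\<Sum>i<n. M x $$ (i, length A) * cofactor (M x) i (length A))"
      by (rule laplace_expansion_column) (auto simp: M_def n_def)
    also have "\<dots> = (\<Sum>i<n. x i * cofactor (M (\<lambda>_. 0)) i (length A))"
    proof (rule sum.cong[OF refl])
      fix i assume "i \<in> {..<n}"
      then have i: "i < n" by simp
      have "mat_delete (M x) i (length A) = mat_delete (M (\<lambda>_. 0)) i (length A)"
        by (rule eq_matI) (auto simp: M_def mat_delete_def nth_append n_def)
      then show "M x $$ (i, length A) * cofactor (M x) i (length A)
          = x i * cofactor (M (\<lambda>_. 0)) i (length A)"
        using i by (simp add: cofactor_def M_def n_def)
    qed
    finally show ?thesis by (simp add: n_def)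
  qed
  then show ?thesis
    by (intro exI[of _ "\<lambda>i. cofactor (M (\<lambda>_. 0)) i (length A)"] allI)
qed

lemma vdet_lin:
  "vdet (A @ (\<lambda>i. a * u i + b * w i) # B) = a * vdet (A @ u # B) + b * vdet (A @ w # B)"
proof -
  obtain c where c: "\<And>x. vdet (A @ x # B) = (\<Sum>i<length (A @ x # B). x i * c i)"
    using vdet_expansion by blast
  show ?thesis
    by (simp only: c) (simp add: sum_distrib_left sum.distrib[symmetric] algebra_simps)
qed

lemma vdet_scale: "vdet (A @ (\<lambda>i. a * u i) # B) = a * vdet (A @ u # B)"
  using vdet_lin[of A a u 0 u B] by simp

lemma vdet_repeat: "vdet (A @ x # B @ x # C) = 0"
  unfolding vdet_def
  by (rule det_identical_columns[of _ _ "length A" "length A + Suc (length B)"])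
    (auto simp: nth_append intro!: eq_vecI)

lemma vdet_swap: "vdet (A @ x # y # B) = - vdet (A @ y # x # B)"
proof -
  define s where "s = (\<lambda>i. 1 * x i + 1 * y i)"
  have "0 = vdet (A @ s # s # B)"
    using vdet_repeat[of A s "[]" B] by simp
  also have "\<dots> = vdet (A @ x # s # B) + vdet (A @ y # s # B)"
    using vdet_lin[of A 1 x 1 y "s # B"] by (simp add: s_def)
  also have "vdet (A @ x # s # B) = vdet (A @ x # y # B)"
    using vdet_lin[of "A @ [x]" 1 x 1 y B] vdet_repeat[of A x "[]" B] by (simp add: s_def)
  also have "vdet (A @ y # s # B) = vdet (A @ y # x # B)"
    using vdet_lin[of "A @ [y]" 1 x 1 y B] vdet_repeat[of A y "[]" B] by (simp add: s_def)
  finally show ?thesis by simp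
qed

lemma vdet_move: "vdet (A @ x # B @ C) = (- 1) ^ length B * vdet (A @ B @ x # C)"
proof (induction B arbitrary: A)
  case (Cons b B)
  have "vdet (A @ x # (b # B) @ C) = - vdet ((A @ [b]) @ x # B @ C)"
    using vdet_swap[of A x b "B @ C"] by simp
  then show ?case using Cons.IH[of "A @ [b]"] by simp
qed simp

lemma vdet_abs_mset_eq:
  assumes "mset L = mset M"
  shows "\<bar>vdet (P @ L)\<bar> = \<bar>vdet (P @ M)\<bar>"
  using assms
proof (induction L arbitrary: P M)
  case (Cons x L)
  then have "x \<in># mset M" by (metis list.set_intros(1) set_mset_mset)
  then obtain M1 M2 where M: "M = M1 @ x # M2" by (auto dest: split_list)
  with Cons.prems have "mset L = mset (M1 @ M2)" by simp
  from Cons.IH[OF this, of "P @ [x]"] show ?case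
    using vdet_move[of P x M1 M2] M by (simp add: abs_mult power_abs)
qed simp

text \<open>Cramer's rule without division: \<open>vdet (L[j := b])\<close> is the
  \<open>j\<close>-th entry of the adjugate applied to \<open>b\<close>, and a matrix times its
  adjugate is the determinant times the identity.\<close>

lemma vdet_cramer_coord:
  assumes i: "i < length L"
  shows "(\<Sum>j<length L. vdet (L[j := b]) * (L ! j) i) = vdet L * b i"
proof -
  define n where "n = length L"
  define M where "M = mat n n (\<lambda>(i, j). (L ! j) i)"
  have M: "M \<in> carrier_mat n n" by (simp add: M_def)
  have repl: "vdet (L[j := b]) = (\<Sum>i<n. b i * cofactor M i j)" if j: "j < n" for j
  proof -
    let ?N = "mat n n (\<lambda>(i, j'). (L[j := b] ! j') i)"
    have "vdet (L[j := b]) = (\<Sum>i<n. ?N $$ (i, j) * cofactor ?N i j)"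
      unfolding vdet_def using j
      by (subst laplace_expansion_column[of _ n j]) (auto simp: n_def)
    also have "\<dots> = (\<Sum>i<n. b i * cofactor M i j)"
    proof (rule sum.cong[OF refl])
      fix i assume "i \<in> {..<n}"
      then have i: "i < n" by simp
      have "mat_delete ?N i j = mat_delete M i j"
        using i j by (intro eq_matI) (auto simp: M_def mat_delete_def)
      then show "?N $$ (i, j) * cofactor ?N i j = b i * cofactor M i j"
        using i j by (simp add: cofactor_def n_def)
    qed
    finally show ?thesis .
  qed
  have "(\<Sum>j<n. vdet (L[j := b]) * (L ! j) i)
      = (\<Sum>j<n. \<Sum>l<n. b l * (M $$ (i, j) * adj_mat M $$ (j, l)))"
    using i[folded n_def] by (intro sum.cong[OF refl])
      (auto simp: repl sum_distrib_left sum_distrib_right adj_mat_def M_def ac_simps intro!: sum.cong)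
  also have "\<dots> = (\<Sum>l<n. b l * (\<Sum>j<n. M $$ (i, j) * adj_mat M $$ (j, l)))"
    by (subst sum.swap) (simp add: sum_distrib_left)
  also have "\<dots> = (\<Sum>l<n. b l * ((M * adj_mat M) $$ (i, l)))"
    using i[folded n_def] M adj_mat(1)[OF M]
    by (intro sum.cong[OF refl] arg_cong2[of _ _ _ _ "(*)"] refl)
      (auto simp: scalar_prod_def atLeast0LessThan)
  also have "\<dots> = (\<Sum>l<n. b l * (if i = l then det M else 0))"
    using i[folded n_def] by (intro sum.cong[OF refl]) (simp add: adj_mat(2)[OF M])
  also have "\<dots> = vdet L * b i"
    using i[folded n_def] by (simp add: if_distrib[of "\<lambda>x. _ * x"] sum.delta vdet_def M_def n_def cong: if_cong)
  finally show ?thesis by (simp add: n_def)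
qed

text \<open>Cramer's rule expresses \<open>vdet L\<close> times \<open>b\<close> by the entries of
  \<open>L\<close>; this is substituted into a determinant that is linear in
  \<open>b\<close>.\<close>

lemma vdet_cramer:
  assumes len: "length L = length (A @ b # B)"
  shows "vdet L * vdet (A @ b # B) = (\<Sum>j<length L. vdet (L[j := b]) * vdet (A @ L ! j # B))"
proof -
  define n where "n = length L"
  obtain c where c: "\<And>x. vdet (A @ x # B) = (\<Sum>i<length (A @ x # B). x i * c i)"
    using vdet_expansion by blast
  have c': "vdet (A @ x # B) = (\<Sum>i<n. x i * c i)" for x
    using c[of x] len by (simp add: n_def)
  have "vdet L * vdet (A @ b # B) = (\<Sum>i<n. (\<Sum>j<n. vdet (L[j := b]) * (L ! j) i) * c i)"
    unfolding c' sum_distrib_left by (intro sum.cong[OF refl]) (simp add: n_def vdet_cramer_coord)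
  also have "\<dots> = (\<Sum>i<n. \<Sum>j<n. vdet (L[j := b]) * (L ! j) i * c i)"
    by (simp add: sum_distrib_right)
  also have "\<dots> = (\<Sum>j<n. \<Sum>i<n. vdet (L[j := b]) * (L ! j) i * c i)"
    by (rule sum.swap)
  also have "\<dots> = (\<Sum>j<n. vdet (L[j := b]) * vdet (A @ L ! j # B))"
    by (simp add: c' sum_distrib_left ac_simps)
  finally show ?thesis by (simp add: n_def)
qed

text \<open>Cramer's rule for the list \<open>c # q # E\<close>: the summands for entries of
  \<open>E\<close> and their replacements repeat a vector and vanish, which leaves three
  terms.\<close>

lemma vdet_plucker:
  "vdet (c # a # E) * vdet (q # b # E)
     = vdet (c # b # E) * vdet (q # a # E) + vdet (c # q # E) * vdet (a # b # E)"
proof -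
  let ?L = "c # q # E"
  have "vdet ?L * vdet ([a] @ b # E)
      = (\<Sum>j<Suc (Suc (length E)). vdet (?L[j := b]) * vdet ([a] @ ?L ! j # E))"
    using vdet_cramer[of ?L "[a]" b E] by simp
  also have "\<dots> = vdet (b # q # E) * vdet (a # c # E) + vdet (c # b # E) * vdet (a # q # E)
      + (\<Sum>j<length E. vdet (c # q # E[j := b]) * vdet (a # E ! j # E))"
    by (subst sum.lessThan_Suc_shift, subst sum.lessThan_Suc_shift) simp
  also have "(\<Sum>j<length E. vdet (c # q # E[j := b]) * vdet (a # E ! j # E)) = 0"
  proof (intro sum.neutral ballI)
    fix j assume "j \<in> {..<length E}"
    then have "E = take j E @ E ! j # drop (Suc j) E"
      by (simp add: id_take_nth_drop)
    then have "vdet ([a] @ E ! j # E) = 0"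
      by (metis vdet_repeat append_Cons)
    then show "vdet (c # q # E[j := b]) * vdet (a # E ! j # E) = 0" by simp
  qed
  finally show ?thesis
    using vdet_swap[of "[]" b q E] vdet_swap[of "[]" a c E] vdet_swap[of "[]" a q E]
    by (simp add: algebra_simps)
qed

section \<open>Positive configurations and lifting from a quotient\<close>

text \<open>Here \<open>m\<close> is one less than the rank, so that \<open>twist m x\<close> is the
  copy of \<open>x\<close> one turn later in the cyclic sequence.\<close>

definition twist :: "nat \<Rightarrow> (nat \<Rightarrow> int) \<Rightarrow> nat \<Rightarrow> int" where
  "twist m x = (\<lambda>i. (- 1) ^ m * x i)"

definition pos_conf :: "nat \<Rightarrow> (nat \<Rightarrow> int) list \<Rightarrow> (nat \<Rightarrow> int) list \<Rightarrow> bool" where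
  "pos_conf K t X \<longleftrightarrow> (\<forall>J. subseq J X \<longrightarrow> length J = K \<longrightarrow> 0 < vdet (J @ t))"

text \<open>Only linear windows are meant; cyclic ones arise by appending twisted initial vectors.
  Lists shorter than \<open>K\<close> qualify vacuously, which starts inductions below.\<close>

definition unimod_windows :: "nat \<Rightarrow> (nat \<Rightarrow> int) list \<Rightarrow> (nat \<Rightarrow> int) list \<Rightarrow> bool" where
  "unimod_windows K t L \<longleftrightarrow> (\<forall>i. i + K \<le> length L \<longrightarrow> vdet (take K (drop i L) @ t) = 1)"

lemma twist_twist [simp]: "twist m (twist m x) = x"
  by (simp add: twist_def fun_eq_iff flip: mult.assoc power_add)

lemma vdet_twist: "vdet (A @ twist m x # B) = (- 1) ^ m * vdet (A @ x # B)"
  unfolding twist_def by (rule vdet_scale)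

lemma vdet_map_twist:
  "vdet (A @ map (twist m) B @ C) = (- 1) ^ (m * length B) * vdet (A @ B @ C)"
proof (induction B arbitrary: A)
  case (Cons b B)
  from Cons.IH[of "A @ [b]"] show ?case
    using vdet_twist[of A m b "map (twist m) B @ C"] by (simp add: power_add)
qed simp

text \<open>Moving \<open>a\<close> past \<open>J\<close> costs one sign per vector, and the twist
  pays for it.\<close>

lemma vdet_rotate: "vdet (J @ twist (length J) a # t) = vdet (a # J @ t)"
  using vdet_twist[of J "length J" a t] vdet_move[of "[]" a J t]
  by (simp flip: mult.assoc power_add)

lemma pos_confD: "pos_conf K t X \<Longrightarrow> subseq J X \<Longrightarrow> length J = K \<Longrightarrow> 0 < vdet (J @ t)"
  by (simp add: pos_conf_def)

lemma pos_conf_subseq: "pos_conf K t X \<Longrightarrow> subseq Y X \<Longrightarrow> pos_conf K t Y"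
  unfolding pos_conf_def using subseq_order.order_trans by blast

text \<open>The subsequences ending in \<open>v\<close> carry the determinants of the quotient by
  \<open>v\<close>, which has rank one less.\<close>

lemma pos_conf_quotient: "pos_conf (Suc K) t (X @ [v]) \<Longrightarrow> pos_conf K (v # t) X"
  unfolding pos_conf_def
  by (metis append.assoc append_Cons append_Nil length_append_singleton subseq_append)

lemma pos_conf_snocI:
  assumes "pos_conf (Suc m) t X"
    and "\<And>J. subseq J X \<Longrightarrow> length J = m \<Longrightarrow> 0 < vdet (J @ p # t)"
  shows "pos_conf (Suc m) t (X @ [p])"
  unfolding pos_conf_def
proof (intro allI impI)
  fix J assume J: "subseq J (X @ [p])" "length J = Suc m"
  then obtain J1 J2 where *: "J = J1 @ J2" "subseq J1 X" "subseq J2 [p]"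
    by (auto elim: subseq_appendE)
  from *(3) consider "J2 = []" | "J2 = [p]"
    by (cases J2) (auto split: if_splits)
  then show "0 < vdet (J @ t)"
  proof cases
    case 1 with * J assms(1) show ?thesis by (auto simp: pos_conf_def)
  next
    case 2 with * J assms(2)[of J1] show ?thesis by auto
  qed
qed

lemma pos_conf_rotate1: "pos_conf (Suc m) t (a # W) \<longleftrightarrow> pos_conf (Suc m) t (W @ [twist m a])"
proof
  assume pos: "pos_conf (Suc m) t (a # W)"
  show "pos_conf (Suc m) t (W @ [twist m a])"
  proof (rule pos_conf_snocI)
    show "pos_conf (Suc m) t W" using pos by (rule pos_conf_subseq) auto
    fix J assume J: "subseq J W" "length J = m"
    then show "0 < vdet (J @ twist m a # t)"
      using pos_confD[OF pos, of "a # J"] vdet_rotate[of J a t] by simp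
  qed
next
  assume pos: "pos_conf (Suc m) t (W @ [twist m a])"
  show "pos_conf (Suc m) t (a # W)"
    unfolding pos_conf_def
  proof (intro allI impI)
    fix J assume J: "subseq J (a # W)" "length J = Suc m"
    show "0 < vdet (J @ t)"
    proof (cases "subseq J W")
      case True
      then have "subseq J (W @ [twist m a])" by (rule subseq_rev_drop_many)
      with pos J show ?thesis by (auto simp: pos_conf_def)
    next
      case False
      with J obtain J' where J': "J = a # J'" "subseq J' W"
        by (cases J) (auto split: if_splits)
      then have "subseq (J' @ [twist m a]) (W @ [twist m a])" by simp
      with pos_confD[OF pos this] J J' vdet_rotate[of J' a t] show ?thesis by simp
    qed
  qed
qed

lemma pos_conf_rotate: "pos_conf (Suc m) t (A @ B) \<longleftrightarrow> pos_conf (Suc m) t (B @ map (twist m) A)"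
proof (induction A arbitrary: B)
  case (Cons a A)
  show ?case
    using Cons.IH[of "B @ [twist m a]"] pos_conf_rotate1[of m t a "A @ B"] by simp
qed simp

text \<open>Let \<open>f\<close> and \<open>g\<close> be the determinants obtained by putting \<open>q\<close>, respectively \<open>c\<close>, in front
  of a subsequence \<open>S\<close> of \<open>W\<close>. By the Pluecker relation \<open>f / g\<close> increases when an entry of \<open>S\<close>
  is replaced by a later one, so positivity at the initial segment of \<open>W\<close> suffices.\<close>

lemma pos_conf_insert:
  assumes pos: "pos_conf (Suc (Suc m)) t (c # W)"
    and cq: "\<And>T. subseq T W \<Longrightarrow> length T = m \<Longrightarrow> 0 < vdet (c # q # T @ t)"
    and len: "Suc m \<le> length W"
    and init: "0 < vdet (q # take (Suc m) W @ t)"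
  shows "pos_conf (Suc (Suc m)) t (c # q # W)"
proof -
  have exchange: "0 < vdet (q # P @ b # R @ t)"
    if sub: "subseq (P @ a # b # R) W" and lenPR: "length P + length R = m"
      and f: "0 < vdet (q # P @ a # R @ t)" for P R a b
  proof -
    let ?E = "P @ R @ t"
    \<comment> \<open>Moving \<open>y\<close> across \<open>P\<close> gives the same sign in both
      factors of each product below, so these signs cancel.\<close>
    have mv: "vdet (x # P @ y # R @ t) = (- 1) ^ length P * vdet (x # y # ?E)" for x y
      using vdet_move[of "[x]" y P "R @ t"] by (simp flip: mult.assoc power_add)
    have sub_a: "subseq (P @ a # R) W" and sub_b: "subseq (P @ b # R) W"
      and sub_0: "subseq (P @ R) W"
      using sub
      by (meson subseq_order.order_trans subseq_append' subseq_Cons2_iff list_emb_Cons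
          subseq_order.order_refl)+
    have g: "0 < vdet (c # P @ a # R @ t)" "0 < vdet (c # P @ b # R @ t)"
      using pos_confD[OF pos, of "c # P @ a # R"] pos_confD[OF pos, of "c # P @ b # R"]
        sub_a sub_b lenPR by auto
    have h: "0 < vdet (c # q # ?E)"
      using cq[of "P @ R"] sub_0 lenPR by simp
    have "subseq (P @ a # b # R) (c # W)"
      using sub by auto
    then have "0 < vdet (P @ a # b # R @ t)"
      using pos_confD[OF pos, of "P @ a # b # R"] lenPR by simp
    also have "vdet (P @ a # b # R @ t) = vdet (a # b # ?E)"
      using vdet_move[of "[a]" b P "R @ t"] vdet_move[of "[]" a P "b # R @ t"]
      by (simp flip: mult.assoc power_add)
    finally have ab: "0 < vdet (a # b # ?E)" .
    have "vdet (c # P @ a # R @ t) * vdet (q # P @ b # R @ t)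
        = vdet (c # a # ?E) * vdet (q # b # ?E)"
      by (simp add: mv flip: power_mult_distrib)
    also have "\<dots> = vdet (c # b # ?E) * vdet (q # a # ?E) + vdet (c # q # ?E) * vdet (a # b # ?E)"
      by (rule vdet_plucker)
    also have "vdet (c # b # ?E) * vdet (q # a # ?E)
        = vdet (c # P @ b # R @ t) * vdet (q # P @ a # R @ t)"
      by (simp add: mv flip: power_mult_distrib)
    also have "\<dots> + vdet (c # q # ?E) * vdet (a # b # ?E) > 0"
      using g f h ab by (simp add: add_pos_pos)
    finally show ?thesis using g by (simp add: zero_less_mult_iff)
  qed
  \<comment> \<open>Induction on the tail \<open>W'\<close> not yet passed. If \<open>R\<close>
    skips the next entry \<open>w\<close>, its first entry \<open>r\<close> is replaced by
    \<open>w\<close>, the induction hypothesis applies, and \<open>exchange\<close> leads from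
    \<open>w\<close> back to the later \<open>r\<close>.\<close>
  have f_pos: "0 < vdet (q # P @ R @ t)"
    if "W = P @ W'" "subseq R W'" "length P + length R = Suc m" for P W' R
    using that
  proof (induction W' arbitrary: P R)
    case Nil
    then show ?case using init by (cases R) auto
  next
    case (Cons w W')
    show ?case
    proof (cases R)
      case Nil
      then show ?thesis using init Cons.prems by simp
    next
      case R: (Cons r R')
      show ?thesis
      proof (cases "subseq R W'")
        case True
        then have "subseq R' W'" using R subseq_Cons' by metis
        then have "0 < vdet (q # P @ w # R' @ t)"
          using Cons.IH[of "P @ [w]" R'] Cons.prems R by simp
        moreover have "subseq (P @ w # r # R') W"
          using True R Cons.prems(1) by (simp add: subseq_append')
        ultimately show ?thesis
          using exchange[of P w r R'] Cons.prems(3) R by simp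
      next
        case False
        with R Cons.prems have "r = w" "subseq R' W'" by (auto split: if_splits)
        then show ?thesis using Cons.IH[of "P @ [w]" R'] Cons.prems R by simp
      qed
    qed
  qed
  show ?thesis
    unfolding pos_conf_def
  proof (intro allI impI)
    fix J assume J: "subseq J (c # q # W)" "length J = Suc (Suc m)"
    show "0 < vdet (J @ t)"
    proof (cases "subseq J (c # W)")
      case True
      with J pos show ?thesis by (simp add: pos_conf_def)
    next
      case False
      then have nW: "\<not> subseq J W" by auto
      have "J \<noteq> []" using J by auto
      then obtain j J' where J': "J = j # J'" by (cases J) auto
      show ?thesis
      proof (cases "subseq J (q # W)")
        case True
        with nW J' have "j = q" "subseq J' W" by (auto split: if_splits)
        then show ?thesis using f_pos[of "[]" W J'] J J' by simp
      next
        case nq: False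
        with J J' have jc: "j = c" "subseq J' (q # W)" by (auto split: if_splits)
        have "\<not> subseq J' W" using False jc J' by simp
        moreover have "J' \<noteq> []" using J J' by auto
        ultimately obtain T where "J' = q # T" "subseq T W"
          using jc by (cases J') (auto split: if_splits)
        then show ?thesis using cq[of T] J J' jc by simp
      qed
    qed
  qed
qed

section \<open>Unimodular windows and lifts modulo a vector\<close>

lemma unimod_windowsD:
  "unimod_windows K t L \<Longrightarrow> L = A @ w @ B \<Longrightarrow> length w = K \<Longrightarrow> vdet (w @ t) = 1"
  unfolding unimod_windows_def by (drule spec[of _ "length A"]) simp

lemma unimod_windows_tl: "unimod_windows K t (a # L) \<Longrightarrow> unimod_windows K t L"
  unfolding unimod_windows_def by (metis Suc_le_mono add_Suc drop_Suc_Cons length_Cons)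

text \<open>An overlap of \<open>K - 1\<close> entries suffices: a window starting in
  \<open>A\<close> ends within \<open>A @ B\<close>, and every other window lies in
  \<open>B @ C\<close>.\<close>

lemma unimod_windows_glue:
  assumes "unimod_windows K t (A @ B)" "unimod_windows K t (B @ C)" "K \<le> Suc (length B)"
  shows "unimod_windows K t (A @ B @ C)"
  unfolding unimod_windows_def
proof (intro allI impI)
  fix i assume i: "i + K \<le> length (A @ B @ C)"
  show "vdet (take K (drop i (A @ B @ C)) @ t) = 1"
  proof (cases "i < length A")
    case True
    with assms(3) have "take K (drop i (A @ B @ C)) = take K (drop i (A @ B))" by simp
    moreover have "i + K \<le> length (A @ B)" using True assms(3) by simp
    ultimately show ?thesis using assms(1) by (simp add: unimod_windows_def)
  next
    case False
    then have "drop i (A @ B @ C) = drop (i - length A) (B @ C)" by simp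
    moreover have "i - length A + K \<le> length (B @ C)" using False i by simp
    ultimately show ?thesis using assms(2) unfolding unimod_windows_def by metis
  qed
qed

definition lifts :: "(nat \<Rightarrow> int) \<Rightarrow> (nat \<Rightarrow> int) \<Rightarrow> (nat \<Rightarrow> int) \<Rightarrow> bool" where
  "lifts v q z \<longleftrightarrow> (\<exists>N. q = (\<lambda>i. N * v i + (- 1) * z i))"

text \<open>Passing \<open>v\<close> over a lift changes the sign, which the minus sign in
  \<open>lifts\<close> undoes, and the multiple of \<open>v\<close> in the lift drops out.\<close>

lemma vdet_lifts:
  "list_all2 (lifts v) b z \<Longrightarrow> vdet (a @ v # b @ t) = vdet (a @ z @ v # t)"
proof (induction b z arbitrary: a rule: list_all2_induct)
  case (Cons q b z zs)
  then obtain N where q: "q = (\<lambda>i. N * v i + (- 1) * z i)" by (auto simp: lifts_def)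
  have "vdet (a @ v # (q # b) @ t) = vdet ((a @ [v]) @ q # b @ t)" by simp
  also have "\<dots> = - vdet (a @ v # z # b @ t)"
    unfolding q using vdet_lin[of "a @ [v]" N v "- 1" z "b @ t"] vdet_repeat[of a v "[]" "b @ t"]
    by simp
  also have "\<dots> = vdet ((a @ [z]) @ v # b @ t)"
    using vdet_swap[of a v z "b @ t"] by simp
  finally show ?case using Cons.IH[of "a @ [z]"] by simp
qed simp

text \<open>Modulo \<open>v\<close> the rank drops by one and the cyclic sign flips. This is the
  sign built into \<open>lifts\<close>, so twisted vectors lift to twisted vectors.\<close>

lemma lifts_twist: "lifts v (twist (Suc m) x) (twist m x)"
  unfolding lifts_def twist_def by (rule exI[of _ 0]) simp

lemma list_all2_lifts_twist: "list_all2 (lifts v) (map (twist (Suc m)) X) (map (twist m) X)"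
  by (simp add: list_all2_conv_all_nth lifts_twist)

lemma list_all2_subseq:
  "subseq T xs \<Longrightarrow> list_all2 P xs ys \<Longrightarrow> \<exists>T'. subseq T' ys \<and> list_all2 P T T'"
proof (induction T xs arbitrary: ys rule: list_emb.induct)
  case (list_emb_Nil xs)
  then show ?case by auto
next
  case (list_emb_Cons T xs x)
  then obtain y ys' where ys: "ys = y # ys'" "list_all2 P xs ys'" by (auto simp: list_all2_Cons1)
  with list_emb_Cons.IH[OF ys(2)] show ?case by auto
next
  case (list_emb_Cons2 x z T xs)
  then obtain y ys' where ys: "ys = y # ys'" "P x y" "list_all2 P xs ys'"
    by (auto simp: list_all2_Cons1)
  with list_emb_Cons2.IH[OF ys(3)] obtain T' where "subseq T' ys'" "list_all2 P T T'" by auto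
  with ys show ?case by (intro exI[of _ "y # T'"]) auto
qed

text \<open>The lifts are added from the last to the first. Determinants of \<open>v\<close> with a
  new \<open>q\<close> are positive by the hypothesis modulo \<open>v\<close>, so
  \<open>pos_conf_insert\<close> leaves one determinant to control: that of \<open>q\<close> with
  the next \<open>Suc m\<close> vectors, which is affine in the multiple of
  \<open>v\<close>.\<close>

lemma pos_conf_lift:
  assumes pos: "pos_conf (Suc (Suc m)) t (X @ [v])"
    and posq: "pos_conf (Suc m) (v # t) (X @ Z)"
    and len: "Suc m \<le> length X"
    and H: "X = H @ H'" "length H \<le> Suc m"
    and uni: "unimod_windows (Suc m) (v # t) (Z @ map (twist m) H)"
  shows "\<exists>Q. list_all2 (lifts v) Q Z \<and> pos_conf (Suc (Suc m)) t (X @ v # Q)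
           \<and> unimod_windows (Suc (Suc m)) t (Q @ map (twist (Suc m)) H)"
  using posq uni
proof (induction Z)
  case Nil
  have "unimod_windows (Suc (Suc m)) t (map (twist (Suc m)) H)"
    using H by (simp add: unimod_windows_def)
  then show ?case using pos by auto
next
  case (Cons z Z)
  have "pos_conf (Suc m) (v # t) (X @ Z)"
    using Cons.prems(1) by (rule pos_conf_subseq) (auto simp: subseq_append')
  moreover have uni': "unimod_windows (Suc m) (v # t) (Z @ map (twist m) H)"
    using Cons.prems(2) unimod_windows_tl by simp
  ultimately obtain Q where Q: "list_all2 (lifts v) Q Z"
      "pos_conf (Suc (Suc m)) t (X @ v # Q)"
      "unimod_windows (Suc (Suc m)) t (Q @ map (twist (Suc m)) H)"
    using Cons.IH by blast
  \<comment> \<open>Rotation puts \<open>v\<close> in front: \<open>W\<close> is what follows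
    \<open>v\<close> cyclically, and \<open>W'\<close> is its counterpart modulo
    \<open>v\<close>.\<close>
  define W where "W = Q @ map (twist (Suc m)) X"
  define W' where "W' = Z @ map (twist m) X"
  have WW': "list_all2 (lifts v) W W'"
    unfolding W_def W'_def by (intro list_all2_appendI Q(1) list_all2_lifts_twist)
  have posW: "pos_conf (Suc (Suc m)) t (v # W)"
    using Q(2) pos_conf_rotate[of "Suc m" t X "v # Q"] by (simp add: W_def)
  have posW': "pos_conf (Suc m) (v # t) (z # W')"
    using Cons.prems(1) pos_conf_rotate[of m "v # t" X "z # Z"] by (simp add: W'_def)
  define S where "S = take (Suc m) W"
  have lenW: "Suc m \<le> length W" using len by (simp add: W_def)
  have S: "subseq S W" "length S = Suc m"
    using lenW by (auto simp: S_def intro: take_is_prefix)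
  define \<alpha> where "\<alpha> = vdet (v # S @ t)"
  define \<beta> where "\<beta> = - vdet (z # S @ t)"
  have \<alpha>: "\<alpha> > 0"
    using pos_confD[OF posW, of "v # S"] S by (simp add: \<alpha>_def)
  \<comment> \<open>With slope \<open>\<alpha> = 1\<close> the value 1 is hit exactly; for any other
    slope a multiple large enough for positivity is taken.\<close>
  define N where "N = (if \<alpha> = 1 then 1 - \<beta> else \<bar>\<beta>\<bar> + 1)"
  have N: "N * \<alpha> + \<beta> > 0" "\<alpha> = 1 \<Longrightarrow> N * \<alpha> + \<beta> = 1"
  proof -
    have "(\<bar>\<beta>\<bar> + 1) * 1 \<le> (\<bar>\<beta>\<bar> + 1) * \<alpha>" using \<alpha> by (intro mult_left_mono) auto
    moreover have "- \<beta> < (\<bar>\<beta>\<bar> + 1) * 1" by simp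
    ultimately have "- \<beta> < (\<bar>\<beta>\<bar> + 1) * \<alpha>" by (rule less_le_trans[rotated])
    then show "N * \<alpha> + \<beta> > 0" by (auto simp: N_def)
  qed (simp add: N_def)
  define q where "q = (\<lambda>i. N * v i + (- 1) * z i)"
  have qz: "lifts v q z" by (auto simp: lifts_def q_def)
  have qS: "vdet (q # S @ t) = N * \<alpha> + \<beta>"
    using vdet_lin[of "[]" N v "- 1" z "S @ t"] by (simp add: q_def \<alpha>_def \<beta>_def)
  have "pos_conf (Suc (Suc m)) t (v # q # W)"
  proof (rule pos_conf_insert[OF posW _ lenW])
    fix T assume T: "subseq T W" "length T = m"
    then obtain T' where T': "subseq T' W'" "list_all2 (lifts v) T T'"
      using list_all2_subseq WW' by blast
    then have "list_all2 (lifts v) (q # T) (z # T')" using qz by simp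
    then have "vdet (v # q # T @ t) = vdet (z # T' @ v # t)"
      using vdet_lifts[of v "q # T" "z # T'" "[]" t] by simp
    also have "\<dots> > 0"
      using pos_confD[OF posW', of "z # T'"] T T' list_all2_lengthD[OF T'(2)] by simp
    finally show "0 < vdet (v # q # T @ t)" .
  next
    show "0 < vdet (q # take (Suc m) W @ t)" using N qS by (simp add: S_def)
  qed
  then have pos_new: "pos_conf (Suc (Suc m)) t (X @ v # q # Q)"
    using pos_conf_rotate[of "Suc m" t X "v # q # Q"] by (simp add: W_def)
  have "unimod_windows (Suc (Suc m)) t ((q # Q) @ map (twist (Suc m)) H)"
    unfolding unimod_windows_def
  proof (intro allI impI)
    fix i assume i: "i + Suc (Suc m) \<le> length ((q # Q) @ map (twist (Suc m)) H)"
    show "vdet (take (Suc (Suc m)) (drop i ((q # Q) @ map (twist (Suc m)) H)) @ t) = 1"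
    proof (cases i)
      case (Suc j)
      then show ?thesis using i Q(3) by (simp add: unimod_windows_def)
    next
      case 0
      \<comment> \<open>A window starting at \<open>q\<close> exists only if \<open>Suc m\<close>
        vectors of \<open>Q\<close> and the twisted \<open>H\<close> follow. Then \<open>S\<close>
        consists of these, so \<open>\<alpha>\<close> is a window determinant modulo
        \<open>v\<close>, that is 1.\<close>
      have S_eq: "S = take (Suc m) (Q @ map (twist (Suc m)) H)"
        using i 0 by (simp add: S_def W_def H(1))
      define S' where "S' = take (Suc m) (Z @ map (twist m) H)"
      have lQZ: "length Q = length Z" using Q(1) by (rule list_all2_lengthD)
      have "list_all2 (lifts v) S S'"
        unfolding S_eq S'_def
        by (intro list_all2_takeI list_all2_appendI Q(1) list_all2_lifts_twist)
      then have "\<alpha> = vdet (S' @ v # t)"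
        unfolding \<alpha>_def using vdet_lifts[of v S S' "[]" t] by simp
      also have "\<dots> = 1"
        using uni' i 0 lQZ unfolding unimod_windows_def S'_def
        by (auto dest: spec[of _ 0])
      finally have "\<alpha> = 1" .
      with N qS have "vdet (q # S @ t) = 1" by simp
      then show ?thesis using 0 by (simp add: S_eq)
    qed
  qed
  with pos_new Q(1) qz show ?case by (intro exI[of _ "q # Q"]) simp
qed

text \<open>Since \<open>length g\<close> is at most \<open>K\<close>, a window starting at or
  before \<open>v\<close> contains \<open>v\<close>, so \<open>vdet_lifts\<close> turns it into a
  window of the quotient. The later windows lie in \<open>B\<close>.\<close>

lemma unimod_windows_lift:
  assumes ll: "list_all2 (lifts v) B B'"
    and uniB: "unimod_windows (Suc K) t B"
    and uni: "unimod_windows K (v # t) (g @ B')"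
    and g: "length g \<le> K"
  shows "unimod_windows (Suc K) t (g @ v # B)"
  unfolding unimod_windows_def
proof (intro allI impI)
  fix i assume i: "i + Suc K \<le> length (g @ v # B)"
  have len: "length B = length B'" using ll by (rule list_all2_lengthD)
  show "vdet (take (Suc K) (drop i (g @ v # B)) @ t) = 1"
  proof (cases "i \<le> length g")
    case True
    let ?r = "K - (length g - i)"
    have "take (Suc K) (drop i (g @ v # B)) = drop i g @ v # take ?r B"
      using True g by (simp add: Suc_diff_le)
    moreover have "take K (drop i (g @ B')) = drop i g @ take ?r B'"
      using True g by simp
    moreover have "vdet (drop i g @ v # take ?r B @ t) = vdet (drop i g @ take ?r B' @ v # t)"
      by (rule vdet_lifts) (rule list_all2_takeI[OF ll])
    moreover have "vdet (take K (drop i (g @ B')) @ v # t) = 1"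
      using uni i len by (simp add: unimod_windows_def)
    ultimately show ?thesis by simp
  next
    case False
    then obtain r where "i = Suc (length g + r)" by (metis less_imp_Suc_add not_le)
    then show ?thesis using uniB i False by (simp add: unimod_windows_def)
  qed
qed

text \<open>The step from rank \<open>Suc m\<close> to the next in the inductions of
  \<open>pos_conf_extend_basis\<close>, \<open>fill_to_vector\<close> and
  \<open>fill_to_flag\<close>.\<close>

lemma lift_windows:
  assumes pos: "pos_conf (Suc (Suc m)) t (X @ [v])"
    and posq: "pos_conf (Suc m) (v # t) (X @ Z)"
    and len: "Suc m \<le> length X"
    and H: "X = H @ H'" "length H \<le> Suc m"
    and g: "length g \<le> Suc m"
    and uni: "unimod_windows (Suc m) (v # t) (g @ Z @ map (twist m) H)"
  obtains Q where "length Q = length Z" "pos_conf (Suc (Suc m)) t (X @ v # Q)"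
    "unimod_windows (Suc (Suc m)) t (g @ v # Q @ map (twist (Suc m)) H)"
proof -
  have "unimod_windows (Suc m) (v # t) (Z @ map (twist m) H)"
    using uni by (induction g) (auto dest: unimod_windows_tl)
  then obtain Q where Q: "list_all2 (lifts v) Q Z" "pos_conf (Suc (Suc m)) t (X @ v # Q)"
      "unimod_windows (Suc (Suc m)) t (Q @ map (twist (Suc m)) H)"
    using pos_conf_lift[OF pos posq len H] by blast
  have "list_all2 (lifts v) (Q @ map (twist (Suc m)) H) (Z @ map (twist m) H)"
    by (intro list_all2_appendI Q(1) list_all2_lifts_twist)
  from unimod_windows_lift[OF this Q(3) uni g] Q list_all2_lengthD[OF Q(1)] that
  show ?thesis by blast
qed

section \<open>Completion to unimodular bases\<close>

text \<open>Equivalently, \<open>t\<close> is a basis of a saturated sublattice of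
  \<open>Z^k\<close>. The absolute value makes the order of the vectors immaterial.\<close>

definition completable :: "nat \<Rightarrow> (nat \<Rightarrow> int) list \<Rightarrow> bool" where
  "completable k t \<longleftrightarrow> (\<exists>M. length (M @ t) = k \<and> \<bar>vdet (M @ t)\<bar> = 1)"

lemma completable_mset_mono:
  assumes "completable k t'" "mset t \<subseteq># mset t'"
  shows "completable k t"
proof -
  obtain M where M: "length (M @ t') = k" "\<bar>vdet (M @ t')\<bar> = 1"
    using assms(1) by (auto simp: completable_def)
  obtain N where N: "mset N = mset t' - mset t" by (metis ex_mset)
  have eq: "mset (M @ t') = mset (M @ N @ t)"
    using assms(2) N by simp
  then have "length (M @ N @ t) = k" using M(1) by (metis size_mset)
  moreover have "\<bar>vdet (M @ N @ t)\<bar> = 1"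
    using vdet_abs_mset_eq[OF eq, of "[]"] M(2) by simp
  ultimately show ?thesis
    unfolding completable_def by (intro exI[of _ "M @ N"]) simp
qed

lemma completable_unimodular: "length L = k \<Longrightarrow> \<bar>vdet L\<bar> = 1 \<Longrightarrow> completable k L"
  unfolding completable_def by (intro exI[of _ "[]"]) simp

lemma completable_full: "completable k t \<Longrightarrow> length t = k \<Longrightarrow> \<bar>vdet t\<bar> = 1"
  unfolding completable_def by auto

lemma completable_twist: "completable k (x # t) \<Longrightarrow> completable k (twist m x # t)"
  unfolding completable_def by (auto simp: vdet_twist abs_mult power_abs)

lemma vdet_mem: "x \<in> set t \<Longrightarrow> vdet (A @ x # B @ t) = 0"
  using vdet_repeat by (metis append.assoc split_list)

lemma vdet_nth_repeat:
  assumes "i \<noteq> j" "i < length L" "j < length L" "L ! i = L ! j"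
  shows "vdet L = 0"
  unfolding vdet_def
  by (rule det_identical_columns[of _ "length L" i j]) (use assms in \<open>auto intro!: eq_vecI\<close>)

lemma vdet_update_lin:
  "j < length L \<Longrightarrow>
    vdet (L[j := \<lambda>i. a * u i + b * w i]) = a * vdet (L[j := u]) + b * vdet (L[j := w])"
  by (simp add: upd_conv_take_nth_drop vdet_lin)

lemma vdet_update_swap:
  assumes "i \<noteq> j" "i < length L" "j < length L"
  shows "vdet (L[j := x, i := y]) = - vdet (L[j := y, i := x])"
proof -
  define s where "s = (\<lambda>l. 1 * x l + 1 * y l)"
  have rep: "vdet (L[j := z, i := z]) = 0" for z
    by (rule vdet_nth_repeat[of i j]) (use assms in auto)
  have "0 = vdet (L[j := s, i := s])" using rep by simp
  also have "\<dots> = vdet (L[j := s, i := x]) + vdet (L[j := s, i := y])"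
    using vdet_update_lin[of i "L[j := s]" 1 x 1 y] assms by (simp add: s_def)
  also have "vdet (L[j := s, i := x]) = vdet (L[j := y, i := x])"
    using vdet_update_lin[of j "L[i := x]" 1 x 1 y] assms rep[of x]
    by (simp add: s_def list_update_swap[of i j])
  also have "vdet (L[j := s, i := y]) = vdet (L[j := x, i := y])"
    using vdet_update_lin[of j "L[i := y]" 1 x 1 y] assms rep[of y]
    by (simp add: s_def list_update_swap[of i j])
  finally show ?thesis by simp
qed

text \<open>A basis minimising the sum of the absolute values of the coordinates of \<open>w\<close> modulo \<open>t\<close> does it:
  two nonzero coordinates could be reduced further by a Euclidean step.\<close>

lemma basis_with_one_coordinate:
  assumes "completable k t" "length t < k"
  obtains M i where "length (M @ t) = k" "\<bar>vdet (M @ t)\<bar> = 1" "i < length M"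
    "\<And>j. j < length M \<Longrightarrow> j \<noteq> i \<Longrightarrow> vdet (M[j := w] @ t) = 0"
proof -
  define basis where "basis M \<longleftrightarrow> length (M @ t) = k \<and> \<bar>vdet (M @ t)\<bar> = 1" for M
  define cost where "cost M = (\<Sum>j<length M. nat \<bar>vdet (M[j := w] @ t)\<bar>)" for M
  obtain M where M: "basis M" and min: "\<And>M'. basis M' \<Longrightarrow> cost M \<le> cost M'"
    using assms(1) ex_has_least_nat[of basis _ cost]
    unfolding completable_def basis_def by metis
  define c where "c j = vdet (M[j := w] @ t)" for j
  have reduce: "False"
    if ij: "i \<noteq> j" "i < length M" "j < length M" and c: "c j \<noteq> 0" "\<bar>c j\<bar> \<le> \<bar>c i\<bar>" for i j
  proof -
    \<comment> \<open>Adding \<open>e\<close> times the \<open>i\<close>-th basis vector to the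
      \<open>j\<close>-th one is a unimodular change; it turns the coordinate \<open>c i\<close>
      into \<open>c i - e * c j\<close> and keeps the others.\<close>
    define e :: int where "e = (if (c i > 0) = (c j > 0) then 1 else - 1)"
    have e: "\<bar>c i - e * c j\<bar> < \<bar>c i\<bar>" using c by (auto simp: e_def)
    define M' where "M' = M[j := \<lambda>l. 1 * (M ! j) l + e * (M ! i) l]"
    have upd: "vdet (M'[l := x] @ t) = vdet (M[l := x] @ t) + e * vdet (M[j := M ! i, l := x] @ t)"
      if "l < length M" "l \<noteq> j" for l x
      using that ij nth_list_update_neq[of l j M x] list_update_id[of "M[l := x]" j]
        vdet_update_lin[of j "M[l := x] @ t" 1 "M ! j" e "M ! i"]
      by (simp add: M'_def list_update_append1 list_update_swap[of j l])
    have rep: "vdet (M[j := M ! i, l := x] @ t) = 0" if "l < length M" "l \<noteq> j" "l \<noteq> i" for l x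
      by (rule vdet_nth_repeat[of i j]) (use that ij in \<open>auto simp: nth_append\<close>)
    have "vdet (M' @ t) = vdet (M @ t)"
      using vdet_update_lin[of j "M @ t" 1 "M ! j" e "M ! i"] ij
        vdet_nth_repeat[of i j "M[j := M ! i] @ t"]
      by (simp add: M'_def nth_append list_update_append1)
    then have "basis M'" using M by (simp add: basis_def M'_def)
    have c': "vdet (M'[l := w] @ t) = (if l = i then c i - e * c j else c l)" if l: "l < length M" for l
    proof (cases "l = j")
      case True
      then show ?thesis using ij by (simp add: M'_def c_def)
    next
      case lj: False
      show ?thesis
      proof (cases "l = i")
        case True
        have "vdet (M[j := M ! i, i := w] @ t) = - vdet (M[j := w, i := M ! i] @ t)"
          using vdet_update_swap[of i j "M @ t" "M ! i" w] ij by (simp add: list_update_append1)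
        also have "M[j := w, i := M ! i] = M[j := w]"
          using ij by (metis list_update_id list_update_swap)
        finally show ?thesis using upd[of i w] True ij by (simp add: c_def)
      next
        case False
        then show ?thesis using upd[of l w] rep[of l w] l lj by (simp add: c_def)
      qed
    qed
    have "cost M' = (\<Sum>l<length M. nat \<bar>if l = i then c i - e * c j else c l\<bar>)"
      unfolding cost_def by (rule sum.cong) (simp add: M'_def, simp add: c')
    also have "\<dots> < cost M"
      unfolding cost_def
      by (rule sum_strict_mono_ex1) (use e ij in \<open>auto simp: c_def intro!: bexI[of _ i]\<close>)
    finally show False using min[OF \<open>basis M'\<close>] by simp
  qed
  have one: "c i = 0 \<or> c j = 0" if "i \<noteq> j" "i < length M" "j < length M" for i j
    using reduce[of i j] reduce[of j i] that by (metis linear)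
  have "0 < length M" using M assms(2) by (auto simp: basis_def)
  then obtain i where "i < length M" "\<And>j. j < length M \<Longrightarrow> j \<noteq> i \<Longrightarrow> c j = 0"
    using one by metis
  with M that show ?thesis by (auto simp: basis_def c_def)
qed

text \<open>Modulo \<open>t\<close>, the vector \<open>w\<close> is \<open>d\<close> times a vector
  \<open>u\<close> that is primitive modulo \<open>t\<close>, namely the one basis vector on which
  \<open>w\<close> may have a nonzero coordinate. Stating this by determinants avoids forming the
  quotient.\<close>

lemma primitive_part:
  assumes "completable k t" "length t < k"
  obtains u d where "completable k (u # t)"
    "\<And>A B. length A + length B + Suc (length t) = k \<Longrightarrow>
       vdet (A @ w # B @ t) = d * vdet (A @ u # B @ t)"
proof -
  obtain M i where M: "length (M @ t) = k" "\<bar>vdet (M @ t)\<bar> = 1" "i < length M"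
      "\<And>j. j < length M \<Longrightarrow> j \<noteq> i \<Longrightarrow> vdet (M[j := w] @ t) = 0"
    using basis_with_one_coordinate[OF assms] by blast
  have "completable k (M @ t)" using M by (intro completable_unimodular)
  then have "completable k (M ! i # t)"
    by (rule completable_mset_mono) (use M(3) in simp)
  moreover have "vdet (A @ w # B @ t) = vdet (M @ t) * vdet (M[i := w] @ t) * vdet (A @ M ! i # B @ t)"
    if "length A + length B + Suc (length t) = k" for A B
  proof -
    have "vdet (M @ t) * vdet (A @ w # B @ t)
        = (\<Sum>j<k. vdet ((M @ t)[j := w]) * vdet (A @ (M @ t) ! j # B @ t))"
      unfolding M(1)[symmetric] by (rule vdet_cramer) (use M(1) that in simp)
    also have "\<dots> = (\<Sum>j<k. if j = i then vdet (M[i := w] @ t) * vdet (A @ M ! i # B @ t) else 0)"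
    proof (rule sum.cong[OF refl])
      fix j assume j: "j \<in> {..<k}"
      show "vdet ((M @ t)[j := w]) * vdet (A @ (M @ t) ! j # B @ t)
          = (if j = i then vdet (M[i := w] @ t) * vdet (A @ M ! i # B @ t) else 0)"
      proof (cases "j < length M")
        case True
        then show ?thesis using M by (simp add: list_update_append1 nth_append)
      next
        case False
        then have "(M @ t) ! j \<in> set t" using j M(1) by (auto simp: nth_append)
        then show ?thesis using False M(3) by (simp add: vdet_mem)
      qed
    qed
    also have "\<dots> = vdet (M[i := w] @ t) * vdet (A @ M ! i # B @ t)"
      using M by (simp add: sum.delta)
    finally have "vdet (M @ t) * (vdet (M @ t) * vdet (A @ w # B @ t))
        = vdet (M @ t) * vdet (M[i := w] @ t) * vdet (A @ M ! i # B @ t)" by simp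
    moreover have "vdet (M @ t) * vdet (M @ t) = 1" using M(2) by (auto simp: abs_if split: if_splits)
    ultimately show ?thesis by (simp flip: mult.assoc)
  qed
  ultimately show ?thesis using that by blast
qed

text \<open>Here \<open>h\<close> lies in the span of \<open>S\<close> and \<open>t\<close>. Modulo
  \<open>M\<close> and \<open>t\<close> it is \<open>d\<close> times a primitive vector, so
  \<open>d\<close> divides its coordinates on \<open>S\<close>; those on \<open>M\<close> vanish. By
  Cramer's rule \<open>d\<close> then divides a determinant \<open>vdet (C @ h # t)\<close> of
  absolute value 1.\<close>

lemma completable_add_complement:
  assumes h: "completable k (h # t)"
    and len: "length (M @ S @ t) = k" and basis: "\<bar>vdet (M @ S @ t)\<bar> = 1" and S: "S \<noteq> []"
    and span: "\<And>j. j < length M \<Longrightarrow> vdet (M[j := h] @ S @ t) = 0"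
  shows "completable k (h # M @ t)"
proof -
  have "completable k (M @ t)"
    by (rule completable_mset_mono[OF completable_unimodular[OF len basis]]) simp
  moreover have "length (M @ t) < k" using len S by (cases S) auto
  ultimately obtain u d where u: "completable k (u # M @ t)"
      and d: "\<And>A B. length A + length B + Suc (length (M @ t)) = k \<Longrightarrow>
         vdet (A @ h # B @ M @ t) = d * vdet (A @ u # B @ M @ t)"
    using primitive_part[of k "M @ t" h] by blast
  obtain C where C: "length (C @ h # t) = k" "\<bar>vdet (C @ h # t)\<bar> = 1"
    using h by (auto simp: completable_def)
  let ?L = "M @ S @ t"
  have "d dvd vdet ?L * vdet (C @ h # t)"
    unfolding vdet_cramer[of ?L C h t, OF trans[OF len C(1)[symmetric]]]
  proof (rule dvd_sum)
    fix j assume "j \<in> {..<length ?L}"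
    then have j: "j < length ?L" by simp
    consider "j < length M" | "length M \<le> j" "j < length (M @ S)" | "length (M @ S) \<le> j"
      by linarith
    then show "d dvd vdet (?L[j := h]) * vdet (C @ ?L ! j # t)"
    proof cases
      case 1
      then show ?thesis using span[of j] by (simp add: list_update_append1)
    next
      case 2
      define i where "i = j - length M"
      have i: "i < length S" "j = length M + i" using 2 by (auto simp: i_def)
      let ?A = "take i S" and ?B = "drop (Suc i) S"
      have "?L[j := h] = M @ ?A @ h # ?B @ t"
        using i by (simp add: list_update_append upd_conv_take_nth_drop)
      moreover have "\<bar>vdet (M @ ?A @ h # ?B @ t)\<bar> = \<bar>vdet (?A @ h # ?B @ M @ t)\<bar>"
        using vdet_abs_mset_eq[of "M @ ?A @ h # ?B @ t" "?A @ h # ?B @ M @ t" "[]"] by simp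
      moreover have "vdet (?A @ h # ?B @ M @ t) = d * vdet (?A @ u # ?B @ M @ t)"
        by (rule d) (use i len in auto)
      ultimately have "d dvd vdet (?L[j := h])" by (metis dvd_abs_iff dvd_triv_left)
      then show ?thesis by simp
    next
      case 3
      then have "?L ! j \<in> set t" using j by (auto simp: nth_append)
      then have "vdet (C @ ?L ! j # t) = 0" using vdet_mem[of "?L ! j" t C "[]"] by simp
      then show ?thesis by simp
    qed
  qed
  moreover have "\<bar>vdet ?L * vdet (C @ h # t)\<bar> = 1" using basis C by (simp add: abs_mult)
  ultimately have "\<bar>d\<bar> = 1" by (metis dvd_abs_iff zdvd1_eq)
  moreover obtain N where N: "length (N @ u # M @ t) = k" "\<bar>vdet (N @ u # M @ t)\<bar> = 1"
    using u by (auto simp: completable_def)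
  ultimately have "\<bar>vdet (N @ h # M @ t)\<bar> = 1"
    using d[of N "[]"] by (simp add: abs_mult)
  with N show ?thesis unfolding completable_def by (intro exI[of _ N]) simp
qed

text \<open>The last window and \<open>t\<close> form a basis; dropping the first vector of that
  window leaves \<open>g\<close>.\<close>

lemma completable_window_suffix:
  assumes "unimod_windows (Suc m) t L" "Suc m \<le> length L" "length t + Suc m = k"
  obtains A g where "L = A @ g" "length g = m" "completable k (g @ t)"
proof -
  define n where "n = length L - Suc m"
  have w: "vdet (drop n L @ t) = 1"
    using assms(1,2) unfolding unimod_windows_def n_def by (auto dest: spec[of _ "length L - Suc m"])
  have "completable k (drop n L @ t)"
    by (rule completable_unimodular) (use w assms in \<open>auto simp: n_def\<close>)
  moreover have "drop n L = L ! n # drop (Suc n) L"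
    using assms(2) by (simp add: Cons_nth_drop_Suc n_def)
  ultimately have "completable k (drop (Suc n) L @ t)"
    by (elim completable_mset_mono) simp
  then show ?thesis
    using that[of "take (Suc n) L" "drop (Suc n) L"] assms(2) by (simp add: n_def)
qed

section \<open>Adding vectors to a positive configuration\<close>

lemma ex_large_multiple:
  fixes a b :: "'a \<Rightarrow> int"
  assumes "finite S" "\<And>x. x \<in> S \<Longrightarrow> 0 < a x"
  shows "\<exists>N. \<forall>x\<in>S. 0 < b x + N * a x"
proof (intro exI ballI)
  fix x assume x: "x \<in> S"
  define N where "N = 1 + (\<Sum>x\<in>S. \<bar>b x\<bar>)"
  have "\<bar>b x\<bar> < N"
    using member_le_sum[OF x, of "\<lambda>x. \<bar>b x\<bar>"] assms(1) by (simp add: N_def)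
  moreover have "N * 1 \<le> N * a x"
    using assms(2)[OF x] calculation by (intro mult_left_mono) auto
  moreover have "- b x \<le> \<bar>b x\<bar>" by simp
  ultimately have "- b x < N * a x" by (metis le_less_trans less_le_trans mult.right_neutral)
  then show "0 < b x + (1 + (\<Sum>x\<in>S. \<bar>b x\<bar>)) * a x"
    unfolding N_def by simp
qed

lemma finite_subseqs: "finite {J. subseq J X \<and> P J}"
  by (rule finite_subset[of _ "set (subseqs X)"]) auto

text \<open>Induction on the rank, modulo the first vector \<open>h\<close> of \<open>H\<close>,
  twisted so that it may stand last. Adding a large multiple of \<open>h'\<close> makes the
  determinants without \<open>h\<close> positive and leaves those with \<open>h\<close>, among them
  the prescribed one, unchanged.\<close>

lemma pos_conf_extend_along:
  assumes "pos_conf (Suc m) t (H @ R)" "length H = m" "0 < vdet (H @ p0 # t)"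
  shows "\<exists>p. pos_conf (Suc m) t (H @ R @ [p]) \<and> vdet (H @ p # t) = vdet (H @ p0 # t)"
  using assms
proof (induction m arbitrary: t H)
  case 0
  then have "pos_conf (Suc 0) t (R @ [p0])" by (intro pos_conf_snocI) auto
  with 0 show ?case by auto
next
  case (Suc m)
  then obtain h H' where H: "H = h # H'" "length H' = m" by (cases H) auto
  define h' where "h' = twist (Suc m) h"
  have rot: "vdet (J @ h' # t) = vdet (h # J @ t)" if "length J = Suc m" for J
    using vdet_rotate[of J h t] that by (simp add: h'_def)
  have "pos_conf (Suc (Suc m)) t (H' @ R @ [h'])"
    using Suc.prems(1) pos_conf_rotate1[of "Suc m" t h "H' @ R"] by (simp add: H h'_def)
  then have "pos_conf (Suc m) (h' # t) (H' @ R)"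
    using pos_conf_quotient[of "Suc m" t "H' @ R"] by simp
  moreover have eq0: "vdet (H' @ p0 # h' # t) = vdet (H @ p0 # t)"
    using rot[of "H' @ [p0]"] H by simp
  ultimately obtain p where p: "pos_conf (Suc m) (h' # t) (H' @ R @ [p])"
      "vdet (H' @ p # h' # t) = vdet (H' @ p0 # h' # t)"
    using Suc.IH[of "h' # t" H'] Suc.prems(3) H by auto
  have "\<exists>N. \<forall>J\<in>{J. subseq J (H' @ R) \<and> length J = Suc m}.
      0 < vdet (J @ p # t) + N * vdet (J @ h' # t)"
  proof (rule ex_large_multiple[OF finite_subseqs])
    fix J assume "J \<in> {J. subseq J (H' @ R) \<and> length J = Suc m}"
    then show "0 < vdet (J @ h' # t)"
      using rot[of J] pos_confD[OF Suc.prems(1), of "h # J"] H by simp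
  qed
  then obtain N where N: "\<And>J. subseq J (H' @ R) \<Longrightarrow> length J = Suc m \<Longrightarrow>
      0 < vdet (J @ p # t) + N * vdet (J @ h' # t)" by blast
  define p' where "p' = (\<lambda>i. 1 * p i + N * h' i)"
  have p': "vdet (A @ p' # B) = vdet (A @ p # B) + N * vdet (A @ h' # B)" for A B
    using vdet_lin[of A 1 p N h' B] by (simp add: p'_def)
  have p'h: "vdet (h # J @ p' # t) = vdet (J @ p # h' # t)" if "length J = m" for J
    using rot[of "J @ [p']"] that p'[of J "h' # t"] vdet_repeat[of J h' "[]" t] by simp
  have "pos_conf (Suc (Suc m)) t ((H @ R) @ [p'])"
  proof (rule pos_conf_snocI[OF Suc.prems(1)])
    fix J assume J: "subseq J (H @ R)" "length J = Suc m"
    show "0 < vdet (J @ p' # t)"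
    proof (cases "subseq J (H' @ R)")
      case True
      then show ?thesis using N J p' by simp
    next
      case False
      with J H obtain J' where J': "J = h # J'" "subseq J' (H' @ R)"
        by (cases J) (auto split: if_splits)
      then have "subseq (J' @ [p]) ((H' @ R) @ [p])" by (simp only: subseq_append)
      then show ?thesis
        using p'h[of J'] J J' pos_confD[OF p(1), of "J' @ [p]"] by simp
    qed
  qed
  moreover have "vdet (H @ p' # t) = vdet (H @ p0 # t)"
    using p'h[of H'] H p(2) eq0 by simp
  ultimately show ?case by auto
qed

lemma pos_conf_extend:
  assumes "pos_conf (Suc m) t X" "Suc m \<le> length X"
  obtains p where "pos_conf (Suc m) t (X @ [p])"
proof -
  have X: "X = take m X @ X ! m # drop (Suc m) X"
    using assms(2) by (simp add: id_take_nth_drop)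
  \<comment> \<open>The vector \<open>X ! m\<close> shows that a positive value can be
    prescribed.\<close>
  have "0 < vdet ((take m X @ [X ! m]) @ t)"
  proof (rule pos_confD[OF assms(1)])
    show "subseq (take m X @ [X ! m]) X"
      using assms(2) by (metis Suc_le_lessD prefix_imp_subseq take_Suc_conv_app_nth take_is_prefix)
  qed (use assms(2) in simp)
  then show ?thesis
    using pos_conf_extend_along[of m t "take m X" "X ! m # drop (Suc m) X" "X ! m"]
      assms X that by (metis Suc_leD append.assoc append_Cons append_Nil length_take min.absorb2)
qed

text \<open>Passing from \<open>p\<close> to its primitive part modulo \<open>t\<close>, with the
  sign of \<open>d\<close>, divides the relevant determinants by the absolute value of
  \<open>d\<close>.\<close>

lemma pos_conf_extend_primitive:
  assumes pos: "pos_conf (Suc m) t X" and len: "Suc m \<le> length X"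
    and t: "completable k t" "length t + Suc m = k"
  obtains y where "pos_conf (Suc m) t (X @ [y])" "completable k (y # t)"
proof -
  obtain p where p: "pos_conf (Suc m) t (X @ [p])" using pos_conf_extend[OF pos len] .
  obtain u d where u: "completable k (u # t)"
    and d: "\<And>A B. length A + length B + Suc (length t) = k \<Longrightarrow>
       vdet (A @ p # B @ t) = d * vdet (A @ u # B @ t)"
    using primitive_part[of k t p] t by auto
  have pJ: "0 < vdet (J @ p # t)" if "subseq J X" "length J = m" for J
    using pos_confD[OF p, of "J @ [p]"] that by simp
  define y where "y = twist (if d > 0 then 0 else 1) u"
  have "pos_conf (Suc m) t (X @ [y])"
  proof (rule pos_conf_snocI[OF pos])
    fix J assume J: "subseq J X" "length J = m"
    then have "0 < d * vdet (J @ u # t)" using pJ[OF J] d[of J "[]"] t by simp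
    then show "0 < vdet (J @ y # t)"
      by (auto simp: y_def vdet_twist zero_less_mult_iff)
  qed
  then show ?thesis using that completable_twist[OF u] by (auto simp: y_def)
qed

text \<open>The first new vector \<open>y\<close> is chosen primitive modulo \<open>t\<close>, the
  others are found modulo \<open>y\<close> and lifted. In rank 1 a positive primitive vector has
  determinant 1.\<close>

lemma pos_conf_extend_basis:
  assumes "pos_conf (Suc m) t X" "Suc m \<le> length X" "completable k t" "length t + Suc m = k"
  shows "\<exists>Y. length Y = Suc m \<and> pos_conf (Suc m) t (X @ Y) \<and> vdet (Y @ t) = 1"
  using assms
proof (induction m arbitrary: t)
  case 0
  obtain y where y: "pos_conf (Suc 0) t (X @ [y])" "completable k (y # t)"
    using pos_conf_extend_primitive[OF 0] .
  have "0 < vdet ([y] @ t)" by (rule pos_confD[OF y(1)]) auto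
  then have "vdet (y # t) = 1" using completable_full[OF y(2)] 0 by simp
  with y show ?case by (intro exI[of _ "[y]"]) simp
next
  case (Suc m)
  obtain y where y: "pos_conf (Suc (Suc m)) t (X @ [y])" "completable k (y # t)"
    using pos_conf_extend_primitive[OF Suc.prems] .
  obtain Y where Y: "length Y = Suc m" "pos_conf (Suc m) (y # t) (X @ Y)" "vdet (Y @ y # t) = 1"
    using Suc.IH[OF pos_conf_quotient[OF y(1)]] Suc.prems y(2) by auto
  have "unimod_windows (Suc m) (y # t) ([] @ Y @ map (twist m) [])"
    using Y by (auto simp: unimod_windows_def)
  then obtain Q where Q: "length Q = length Y" "pos_conf (Suc (Suc m)) t (X @ y # Q)"
      "unimod_windows (Suc (Suc m)) t ([] @ y # Q @ map (twist (Suc m)) [])"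
    using lift_windows[OF y(1) Y(2), of "[]" X "[]"] Suc.prems(2) by auto
  have "vdet ((y # Q) @ t) = 1"
    using Q Y by (intro unimod_windowsD[OF Q(3), of "[]" "y # Q" "[]"]) auto
  with Q Y show ?case by (intro exI[of _ "y # Q"]) auto
qed

section \<open>Filling gaps\<close>

text \<open>The vector \<open>h'\<close> is \<open>f + N\<^sub>1 (\<plusminus> h) + N\<^sub>2 v\<close>, where \<open>f\<close> is primitive modulo the saturation of the
  lattice spanned by \<open>v\<close> and \<open>h\<close>; this makes both pairs \<open>v, h'\<close> and \<open>h', h\<close> primitive at once,
  whatever \<open>N\<^sub>1\<close> and \<open>N\<^sub>2\<close> are.\<close>

lemma pos_conf_bridge:
  assumes pos: "pos_conf (Suc m) t (h # X @ [v])" and m: "2 \<le> m" and lenX: "m \<le> Suc (length X)"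
    and h: "completable k (h # t)" and v: "completable k (v # t)" and k: "length t + Suc m = k"
  obtains h' where "pos_conf (Suc m) t (h # X @ [v, h'])"
    "completable k (h' # v # t)" "completable k (h # h' # t)"
proof -
  obtain u d where u: "completable k (u # v # t)"
    and d: "\<And>A B. length A + length B + Suc (length (v # t)) = k \<Longrightarrow>
       vdet (A @ h # B @ v # t) = d * vdet (A @ u # B @ v # t)"
    using primitive_part[of k "v # t" h] v k m by auto
  obtain f0 where f0: "pos_conf (Suc m) t ((h # X @ [v]) @ [f0])"
    using pos_conf_extend[OF pos] lenX by auto
  obtain f1 e where f1: "completable k (f1 # u # v # t)"
    and e: "\<And>A B. length A + length B + Suc (length (u # v # t)) = k \<Longrightarrow>
       vdet (A @ f0 # B @ u # v # t) = e * vdet (A @ f1 # B @ u # v # t)"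
    using primitive_part[of k "u # v # t" f0] u k m by auto
  \<comment> \<open>Since \<open>h\<close> is \<open>d * u\<close> modulo \<open>v\<close> and
    \<open>t\<close>, a determinant containing \<open>h\<close> and \<open>v\<close> is a multiple
    of one containing \<open>u\<close> and \<open>v\<close>, with a factor independent of
    \<open>x\<close>.\<close>
  have hvf: "vdet (h # J @ v # x # t) = (- 1) ^ m * (d * vdet (J @ x # u # v # t))"
    if "length J + 2 = m" for J x
  proof -
    have "vdet (h # J @ v # x # t) = (- 1) ^ m * vdet (J @ v # x # h # t)"
      using vdet_move[of "[]" h "J @ [v, x]" t] by (simp flip: that)
    also have "vdet (J @ v # x # h # t) = vdet ((J @ [x]) @ h # [] @ v # t)"
      using vdet_move[of J v "[x, h]" t] by simp
    also have "\<dots> = d * vdet (J @ x # u # v # t)"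
      using d[of "J @ [x]" "[]"] that k by simp
    finally show ?thesis .
  qed
  \<comment> \<open>With this sign, determinants containing both \<open>h\<close> and
    \<open>v\<close> stay positive when \<open>f0\<close> is replaced by \<open>f\<close>. Adding
    multiples of \<open>h\<close> and \<open>v\<close> cannot alter them later.\<close>
  define f where "f = twist (if e > 0 then 0 else 1) f1"
  have f: "completable k (f # u # v # t)" using f1 by (simp add: f_def completable_twist)
  have hvf_pos: "0 < vdet (h # J @ v # f # t)" if J: "subseq J X" "length J + 2 = m" for J
  proof -
    have "subseq (h # J @ [v, f0]) (h # X @ [v, f0])"
      using J by simp
    then have "0 < vdet (h # J @ v # f0 # t)"
      using pos_confD[OF f0, of "h # J @ [v, f0]"] J by simp
    also have "\<dots> = e * ((- 1) ^ m * (d * vdet (J @ f1 # u # v # t)))"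
      using hvf[of J f0] e[of J "[]"] J k by simp
    also have "\<dots> = e * vdet (h # J @ v # f1 # t)"
      using hvf[of J f1] J by simp
    finally show ?thesis
      using vdet_twist[of "h # J @ [v]" _ f1 t] by (auto simp: f_def zero_less_mult_iff)
  qed
  \<comment> \<open>\<open>w\<close> is \<open>h\<close> rotated to the end. The multiple
    \<open>N1\<close> of \<open>w\<close> settles the subsequences that contain \<open>v\<close> but
    not \<open>h\<close>; then the multiple \<open>N2\<close> of \<open>v\<close> settles those
    without \<open>v\<close>.\<close>
  define w where "w = twist m h"
  have w_rot: "vdet (J @ w # t) = vdet (h # J @ t)" if "length J = m" for J
    using vdet_rotate[of J h t] that by (simp add: w_def)
  have w0: "vdet (A @ w # B) = 0" if "vdet (A @ h # B) = 0" for A B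
    using that by (simp add: w_def vdet_twist)
  have "\<exists>N. \<forall>J\<in>{J. subseq J (X @ [v]) \<and> length J = m}. 0 < vdet (J @ f # t) + N * vdet (J @ w # t)"
    by (rule ex_large_multiple[OF finite_subseqs])
      (use w_rot pos_confD[OF pos, of "h # _"] in auto)
  then obtain N1 where N1: "\<And>J. subseq J (X @ [v]) \<Longrightarrow> length J = m \<Longrightarrow>
      0 < vdet (J @ f # t) + N1 * vdet (J @ w # t)" by blast
  define f' where "f' = (\<lambda>i. 1 * f i + N1 * w i)"
  have f': "vdet (A @ f' # B) = vdet (A @ f # B) + N1 * vdet (A @ w # B)" for A B
    using vdet_lin[of A 1 f N1 w B] by (simp add: f'_def)
  have v_pos: "0 < vdet (J @ v # t)" if "subseq J (h # X)" "length J = m" for J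
  proof -
    have "subseq (J @ [v]) ((h # X) @ [v])" using that by (simp only: subseq_append)
    then show ?thesis using pos_confD[OF pos, of "J @ [v]"] that by simp
  qed
  have "\<exists>N. \<forall>J\<in>{J. subseq J (h # X) \<and> length J = m}. 0 < vdet (J @ f' # t) + N * vdet (J @ v # t)"
    by (rule ex_large_multiple[OF finite_subseqs]) (use v_pos in auto)
  then obtain N2 where N2: "\<And>J. subseq J (h # X) \<Longrightarrow> length J = m \<Longrightarrow>
      0 < vdet (J @ f' # t) + N2 * vdet (J @ v # t)" by blast
  define h' where "h' = (\<lambda>i. 1 * f' i + N2 * v i)"
  have h'f': "vdet (A @ h' # B) = vdet (A @ f' # B) + N2 * vdet (A @ v # B)" for A B
    using vdet_lin[of A 1 f' N2 v B] by (simp add: h'_def)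
  then have h': "vdet (A @ h' # B)
      = vdet (A @ f # B) + N1 * vdet (A @ w # B) + N2 * vdet (A @ v # B)" for A B
    using f' by simp
  have "pos_conf (Suc m) t ((h # X @ [v]) @ [h'])"
  proof (rule pos_conf_snocI[OF pos])
    fix J assume J: "subseq J (h # X @ [v])" "length J = m"
    then obtain J1 J2 where J12: "J = J1 @ J2" "subseq J1 (h # X)" "subseq J2 [v]"
      using subseq_appendE[of J "h # X" "[v]"] by auto
    from J12(3) consider "J2 = []" | "J2 = [v]"
      by (cases J2) (auto split: if_splits)
    then show "0 < vdet (J @ h' # t)"
    proof cases
      case 1
      then show ?thesis using N2[of J] J J12 h'f' by simp
    next
      case 2
      have eq: "vdet (J @ h' # t) = vdet (J @ f # t) + N1 * vdet (J @ w # t)"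
        using h'[of J t] vdet_repeat[of J1 v "[]" t] J12 2 by simp
      show ?thesis
      proof (cases "subseq J1 X")
        case True
        then have "subseq J (X @ [v])" using J12 2 by simp
        then show ?thesis using N1 J eq by simp
      next
        case False
        then obtain J' where J': "J1 = h # J'" "subseq J' X"
          using J12 by (cases J1) (auto split: if_splits)
        have "vdet (J @ w # t) = 0"
          by (rule w0) (use vdet_repeat[of "[]" h "J' @ [v]" t] J12 2 J' in simp)
        then show ?thesis using hvf_pos[of J'] J' J12 2 J eq by simp
      qed
    qed
  qed
  moreover
  obtain M where M: "length (M @ f # u # v # t) = k" "\<bar>vdet (M @ f # u # v # t)\<bar> = 1"
    using f by (auto simp: completable_def)
  have "completable k (h' # v # t)"
  proof -
    have "vdet (M @ u # h # v # t) = 0"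
      using d[of "M @ [u]" "[]"] M(1) vdet_repeat[of M u "[]" "v # t"] by simp
    then have "vdet (M @ u # h' # v # t) = vdet (M @ u # f # v # t)"
      using h'[of "M @ [u]" "v # t"] vdet_repeat[of "M @ [u]" v "[]" t] w0[of "M @ [u]" "v # t"]
      by simp
    then have "\<bar>vdet (M @ u # h' # v # t)\<bar> = 1"
      using M(2) vdet_swap[of M u f "v # t"] by simp
    then show ?thesis
      using M(1) unfolding completable_def by (intro exI[of _ "M @ [u]"]) simp
  qed
  moreover
  \<comment> \<open>\<open>M\<close>, \<open>h'\<close>, \<open>u\<close>, \<open>v\<close> and
    \<open>t\<close> form a basis, and \<open>h\<close> lies in the span of \<open>u\<close>,
    \<open>v\<close> and \<open>t\<close>, so \<open>completable_add_complement\<close>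
    applies.\<close>
  have "completable k (h # h' # t)"
  proof -
    have "vdet (M @ h # u # v # t) = 0"
      using d[of M "[u]"] M(1) vdet_repeat[of M u "[]" "v # t"] by simp
    then have "vdet (M @ h' # u # v # t) = vdet (M @ f # u # v # t)"
      using h'[of M "u # v # t"] vdet_repeat[of M v "[u]" t] w0[of M "u # v # t"] by simp
    then have "\<bar>vdet ((M @ [h']) @ [u, v] @ t)\<bar> = 1"
      using M(2) by simp
    moreover have "vdet ((M @ [h'])[j := h] @ [u, v] @ t) = 0" if "j < length (M @ [h'])" for j
    proof -
      let ?A = "take j (M @ [h'])" and ?B = "drop (Suc j) (M @ [h'])"
      have "(M @ [h'])[j := h] @ [u, v] @ t = ?A @ h # (?B @ [u]) @ v # t"
        unfolding upd_conv_take_nth_drop[OF that] by simp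
      moreover have "length ?A + length (?B @ [u]) + Suc (length (v # t)) = k"
        using that M(1) by auto
      ultimately have "vdet ((M @ [h'])[j := h] @ [u, v] @ t) = d * vdet (?A @ u # (?B @ [u]) @ v # t)"
        using d by metis
      also have "\<dots> = 0"
        using vdet_repeat[of ?A u ?B "v # t"] by simp
      finally show ?thesis .
    qed
    ultimately have "completable k (h # (M @ [h']) @ t)"
      using M(1) by (intro completable_add_complement[OF h, of "M @ [h']" "[u, v]"]) auto
    then show ?thesis by (rule completable_mset_mono) simp
  qed
  ultimately show ?thesis using that by simp
qed

text \<open>The gap lies between \<open>g\<close>, the \<open>m\<close> vectors before it in all
  uses, and \<open>h\<close>, which follows one turn later as \<open>twist m h\<close>. The vectors
  \<open>Y\<close> only take part in positivity.\<close>

definition fillable :: "nat \<Rightarrow> (nat \<Rightarrow> int) list \<Rightarrow> (nat \<Rightarrow> int) \<Rightarrow> (nat \<Rightarrow> int) list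
    \<Rightarrow> (nat \<Rightarrow> int) list \<Rightarrow> bool" where
  "fillable m t h Y g \<longleftrightarrow> (\<exists>Z. pos_conf (Suc m) t (h # Y @ g @ Z)
      \<and> unimod_windows (Suc m) t (g @ Z @ [twist m h]))"

text \<open>Rotated to the front, \<open>h'\<close> becomes \<open>twist m h'\<close>, so
  \<open>spec\<close> fills the gap from \<open>v\<close> to \<open>h'\<close>. The last
  \<open>m\<close> vectors then end in \<open>h'\<close> and are completable with \<open>t\<close>,
  so \<open>cont\<close> fills the gap from \<open>h'\<close> to \<open>h\<close>. Both fillings
  share these \<open>m\<close> vectors and can be glued.\<close>

lemma fillable_via:
  assumes spec: "\<And>h Y g v. pos_conf (Suc m) t (h # Y @ g @ [v]) \<Longrightarrow> Suc (length g) = m \<Longrightarrow>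
      completable k (g @ v # t) \<Longrightarrow> completable k (h # t) \<Longrightarrow> completable k (h # v # t) \<Longrightarrow>
      fillable m t h Y (g @ [v])"
    and pos: "pos_conf (Suc m) t (h # Y @ g @ [v, h'])" and g: "Suc (length g) = m"
    and cg: "completable k (g @ v # t)" and h': "completable k (h' # v # t)"
    and k: "length t + Suc m = k"
    and cont: "\<And>Y2 g2. pos_conf (Suc m) t (h # Y2 @ g2 @ [h']) \<Longrightarrow> Suc (length g2) = m \<Longrightarrow>
      completable k (g2 @ h' # t) \<Longrightarrow> fillable m t h Y2 (g2 @ [h'])"
  shows "fillable m t h Y (g @ [v])"
proof -
  have "pos_conf (Suc m) t (twist m h' # (h # Y) @ g @ [v])"
    using pos pos_conf_rotate1[of m t "twist m h'" "h # Y @ g @ [v]"] by simp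
  moreover have "completable k (twist m h' # v # t)" using h' by (rule completable_twist)
  moreover from this have "completable k (twist m h' # t)"
    by (rule completable_mset_mono) simp
  ultimately have "fillable m t (twist m h') (h # Y) (g @ [v])"
    using spec g cg by blast
  then obtain Z where Z: "pos_conf (Suc m) t (twist m h' # h # Y @ g @ [v] @ Z)"
      "unimod_windows (Suc m) t (g @ [v] @ Z @ [h'])"
    by (auto simp: fillable_def)
  have posZ: "pos_conf (Suc m) t (h # Y @ g @ [v] @ Z @ [h'])"
    using Z(1) pos_conf_rotate1[of m t "twist m h'" "h # Y @ g @ [v] @ Z"] by simp
  obtain A g' where Ag': "g @ [v] @ Z @ [h'] = A @ g'" "length g' = m" "completable k (g' @ t)"
    using completable_window_suffix[OF Z(2)] g k by auto
  then obtain g2 where g2: "g' = g2 @ [h']" "Suc (length g2) = m"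
    using g by (cases g' rule: rev_cases) auto
  have "fillable m t h (Y @ A) (g2 @ [h'])"
  proof (rule cont)
    have "h # (Y @ A) @ g2 @ [h'] = h # Y @ g @ [v] @ Z @ [h']" using Ag' g2 by simp
    then show "pos_conf (Suc m) t (h # (Y @ A) @ g2 @ [h'])" using posZ by metis
  qed (use Ag' g2 in auto)
  then obtain Z2 where Z2: "pos_conf (Suc m) t (h # (Y @ A) @ g' @ Z2)"
      "unimod_windows (Suc m) t (g' @ Z2 @ [twist m h])"
    by (auto simp: fillable_def g2)
  have "unimod_windows (Suc m) t (A @ g' @ Z2 @ [twist m h])"
    by (rule unimod_windows_glue) (use Z(2) Z2(2) Ag' in auto)
  moreover have eq: "A @ g' @ W = (g @ [v]) @ (Z @ [h']) @ W" for W
    using Ag'(1) by (metis append.assoc)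
  moreover have "pos_conf (Suc m) t (h # Y @ (g @ [v]) @ (Z @ [h']) @ Z2)"
    using Z2(1) eq[of Z2] by (metis append.assoc)
  ultimately show ?thesis
    unfolding fillable_def by (intro exI[of _ "Z @ [h'] @ Z2"]) simp
qed

text \<open>Descent on \<open>d = vdet (h # v # t)\<close>. The inserted \<open>h'\<close> has
  determinant 1 with \<open>v\<close>, so \<open>spec\<close> fills the first gap; its determinant
  with \<open>h\<close> lies strictly between 0 and \<open>d\<close>, so induction fills the
  second.\<close>

lemma fillable_rank2:
  assumes spec: "\<And>h Y g v. pos_conf 2 t (h # Y @ g @ [v]) \<Longrightarrow> Suc (length g) = 1 \<Longrightarrow>
      completable k (g @ v # t) \<Longrightarrow> completable k (h # t) \<Longrightarrow> completable k (h # v # t) \<Longrightarrow>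
      fillable 1 t h Y (g @ [v])"
    and k: "length t + 2 = k" and h: "completable k (h # t)"
  shows "pos_conf 2 t (h # Y @ [v]) \<Longrightarrow> completable k (v # t) \<Longrightarrow> fillable 1 t h Y [v]"
proof (induction "nat (vdet (h # v # t))" arbitrary: Y v rule: less_induct)
  case less
  define d where "d = vdet (h # v # t)"
  have "subseq [v] (Y @ [v])" by (rule subseq_drop_many) simp
  then have "subseq [h, v] (h # Y @ [v])" by (rule subseq_Cons2)
  from pos_confD[OF less.prems(1) this] have d: "0 < d" by (simp add: d_def)
  show ?case
  proof (cases "d = 1")
    case True
    then have "completable k (h # v # t)"
      using k by (intro completable_unimodular) (auto simp: d_def)
    then show ?thesis using spec[of h Y "[]" v] less.prems h by simp
  next
    case False
    obtain M where M: "length (M @ v # t) = k" "\<bar>vdet (M @ v # t)\<bar> = 1"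
      using less.prems(2) by (auto simp: completable_def)
    then obtain b' where "M = [b']" using k by (cases M) auto
    define b where "b = twist (if vdet (b' # v # t) = 1 then 1 else 0) b'"
    have b: "vdet (b # v # t) = - 1"
      using M \<open>M = [b']\<close> vdet_twist[of "[]" _ b' "v # t"]
      by (auto simp: b_def abs_if split: if_splits)
    \<comment> \<open>Adding a multiple of \<open>v\<close> to \<open>b\<close> reduces its
      determinant with \<open>h\<close> modulo \<open>d\<close> and keeps its determinant with
      \<open>v\<close>.\<close>
    define r where "r = vdet (h # b # t) mod d"
    define N where "N = - (vdet (h # b # t) div d)"
    define h' where "h' = (\<lambda>i. 1 * b i + N * v i)"
    have h': "vdet (A @ h' # B) = vdet (A @ b # B) + N * vdet (A @ v # B)" for A B
      using vdet_lin[of A 1 b N v B] by (simp add: h'_def)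
    have hr: "vdet (h # h' # t) = r"
      using h'[of "[h]" t] minus_div_mult_eq_mod[of "vdet (h # b # t)" d]
      by (simp add: r_def N_def d_def)
    have vh': "vdet (v # h' # t) = 1"
      using h'[of "[v]" t] vdet_repeat[of "[]" v "[]" t] vdet_swap[of "[]" v b t] b by simp
    \<comment> \<open>Otherwise, by Cramer's rule in the basis \<open>b\<close>, \<open>v\<close>,
      \<open>t\<close>, all determinants of \<open>h\<close> with a further vector and
      \<open>t\<close> would be divisible by \<open>d\<close>, although one of them is 1 or
      -1.\<close>
    have r0: "r \<noteq> 0"
    proof
      assume "r = 0"
      then have db: "d dvd vdet (h # b # t)" by (auto simp: r_def)
      obtain C where C: "length (C @ h # t) = k" "\<bar>vdet (C @ h # t)\<bar> = 1"
        using h by (auto simp: completable_def)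
      then obtain c where c: "C = [c]" using k by (cases C) auto
      have "vdet (b # v # t) * vdet ([h] @ c # t)
          = (\<Sum>j<length (b # v # t). vdet ((b # v # t)[j := c]) * vdet ([h] @ (b # v # t) ! j # t))"
        by (rule vdet_cramer) simp
      also have "d dvd \<dots>"
      proof (rule dvd_sum)
        fix j assume j: "j \<in> {..<length (b # v # t)}"
        consider "j = 0" | "j = 1" | i where "j = Suc (Suc i)" "i < length t"
          using j by (metis One_nat_def Suc_less_eq lessThan_iff length_Cons not0_implies_Suc)
        then have "d dvd vdet ([h] @ (b # v # t) ! j # t)"
        proof cases
          case 3
          then show ?thesis using vdet_mem[of "t ! i" t "[h]" "[]"] by simp
        qed (use db in \<open>auto simp: d_def\<close>)
        then show "d dvd vdet ((b # v # t)[j := c]) * vdet ([h] @ (b # v # t) ! j # t)" by simp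
      qed
      finally have "d dvd vdet (h # c # t)" using b by simp
      moreover have "\<bar>vdet (h # c # t)\<bar> = 1"
        using C c vdet_swap[of "[]" h c t] by simp
      ultimately show False using d False by (metis dvd_abs_iff zdvd1_eq abs_of_pos)
    qed
    moreover have "0 \<le> r" "r < d" using d by (auto simp: r_def)
    ultimately have r: "0 < r" "r < d" by auto
    have "pos_conf (Suc (Suc 0)) t (v # map (twist 1) (h # Y))"
      using less.prems(1) pos_conf_rotate[of 1 t "h # Y" "[v]"] by (simp add: numeral_2_eq_2)
    then have "pos_conf (Suc (Suc 0)) t (v # h' # map (twist 1) (h # Y))"
    proof (rule pos_conf_insert)
      show "0 < vdet (h' # take (Suc 0) (map (twist 1) (h # Y)) @ t)"
        using hr r vdet_twist[of "[h']" 1 h t] vdet_swap[of "[]" h h' t] by simp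
    qed (use vh' in auto)
    then have pos': "pos_conf 2 t (h # Y @ [v, h'])"
      using pos_conf_rotate[of 1 t "h # Y" "[v, h']"] by (simp add: numeral_2_eq_2)
    have "fillable 1 t h Y ([] @ [v])"
    proof (rule fillable_via[where k = k and h' = h'])
      show "completable k (h' # v # t)"
        by (rule completable_unimodular) (use k vh' vdet_swap[of "[]" v h' t] in auto)
    next
      fix Y2 g2
      assume *: "pos_conf (Suc 1) t (h # Y2 @ g2 @ [h'])" "Suc (length g2) = 1"
        "completable k (g2 @ h' # t)"
      then show "fillable 1 t h Y2 (g2 @ [h'])"
        using less.hyps[of h' Y2] hr r d by (simp add: numeral_2_eq_2 d_def)
    qed (use spec pos' k less.prems(2) in \<open>auto simp: numeral_2_eq_2\<close>)
    then show ?thesis by simp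
  qed
qed

text \<open>Induction on the rank. If the last vector \<open>v\<close> and \<open>h\<close> are
  completable together with \<open>t\<close>, the gap is filled modulo \<open>v\<close> and lifted
  (\<open>spec\<close>). The general case is reduced to this by intermediate vectors: one bridge in
  rank at least 3, the descent in rank 2.\<close>

lemma fill_to_vector:
  assumes "pos_conf (Suc m) t (h # Y @ g)" "length g = m" "length t + Suc m = k"
    "completable k (g @ t)" "completable k (h # t)"
  shows "fillable m t h Y g"
  using assms
proof (induction m arbitrary: t h Y g)
  case 0
  then have "vdet ([h] @ t) > 0" by (intro pos_confD[OF 0(1)]) auto
  then have "vdet (h # t) = 1" using completable_full[OF 0(5)] 0(3) by simp
  then have "unimod_windows (Suc 0) t [twist 0 h]"
    by (auto simp: unimod_windows_def twist_def)
  then show ?case using 0 by (auto simp: fillable_def intro!: exI[of _ "[]"])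
next
  case (Suc m)
  have spec: "fillable (Suc m) t h Y (g @ [v])"
    if pos: "pos_conf (Suc (Suc m)) t (h # Y @ g @ [v])" and g: "Suc (length g) = Suc m"
      and cg: "completable k (g @ v # t)" and ch: "completable k (h # v # t)" for h Y g v
  proof -
    have "pos_conf (Suc m) (v # t) (h # Y @ g)"
      using pos_conf_quotient[of "Suc m" t "h # Y @ g" v] pos by simp
    then have "fillable m (v # t) h Y g"
      using Suc.IH[of "v # t" h Y g] g cg ch Suc.prems(3) by simp
    then obtain Z where Z: "pos_conf (Suc m) (v # t) ((h # Y @ g) @ Z)"
        "unimod_windows (Suc m) (v # t) (g @ Z @ map (twist m) [h])"
      by (auto simp: fillable_def)
    have "pos_conf (Suc (Suc m)) t ((h # Y @ g) @ [v])" "Suc m \<le> length (h # Y @ g)"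
        "h # Y @ g = [h] @ (Y @ g)" "length [h] \<le> Suc m" "length g \<le> Suc m"
      using pos g by simp_all
    from lift_windows[OF this(1) Z(1) this(2-5) Z(2)]
    obtain Q where "pos_conf (Suc (Suc m)) t ((h # Y @ g) @ v # Q)"
        "unimod_windows (Suc (Suc m)) t (g @ v # Q @ map (twist (Suc m)) [h])" .
    then show ?thesis by (auto simp: fillable_def)
  qed
  from Suc.prems(2) obtain g' v where g: "g = g' @ [v]" "length g' = m"
    by (cases g rule: rev_cases) auto
  have cv: "completable k (v # t)"
    using Suc.prems(4) by (rule completable_mset_mono) (simp add: g)
  show ?case
  proof (cases m)
    case 0
    have "fillable 1 t h Y [v]"
      by (rule fillable_rank2[where k = k])
        (use spec Suc.prems g 0 cv in \<open>auto simp: numeral_2_eq_2\<close>)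
    then show ?thesis using g 0 by simp
  next
    case (Suc m')
    have "pos_conf (Suc (Suc m)) t (h # (Y @ g') @ [v])" using Suc.prems(1) g by simp
    then obtain h' where h': "pos_conf (Suc (Suc m)) t (h # (Y @ g') @ [v, h'])"
        "completable k (h' # v # t)" "completable k (h # h' # t)"
      using pos_conf_bridge[of "Suc m" t h "Y @ g'" v k] Suc g Suc.prems cv by auto
    show ?thesis
      unfolding g
    proof (rule fillable_via[where k = k and h' = h'])
      fix Y2 g2
      assume "pos_conf (Suc (Suc m)) t (h # Y2 @ g2 @ [h'])" "Suc (length g2) = Suc m"
        "completable k (g2 @ h' # t)"
      then show "fillable (Suc m) t h Y2 (g2 @ [h'])" using spec h'(3) by blast
    qed (use spec h' g Suc.prems in auto)
  qed
qed

text \<open>Here the windows reaching into the whole twisted \<open>H\<close> are controlled as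
  well. The gap is filled up to a vector \<open>p\<close> with \<open>vdet (H @ p # t) = 1\<close>.
  Modulo \<open>p\<close> the induction hypothesis closes up with all of \<open>H\<close> but its
  last vector, and the choice of \<open>p\<close> settles the one remaining window.\<close>

lemma fill_to_flag:
  assumes "pos_conf (Suc m) t (H @ Y @ g)" "length H = m" "length g = m" "length t + Suc m = k"
    "completable k (H @ t)" "completable k (g @ t)"
  shows "\<exists>Z. pos_conf (Suc m) t (H @ Y @ g @ Z)
      \<and> unimod_windows (Suc m) t (g @ Z @ map (twist m) H)"
  using assms
proof (induction m arbitrary: t H Y g)
  case 0
  then show ?case by (intro exI[of _ "[]"]) (simp add: unimod_windows_def)
next
  case (Suc m)
  obtain M where M: "length (M @ H @ t) = k" "\<bar>vdet (M @ H @ t)\<bar> = 1"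
    using Suc.prems(5) by (auto simp: completable_def)
  then obtain p1 where "M = [p1]" using Suc.prems(2,4) by (cases M) auto
  then have p1: "\<bar>vdet (H @ p1 # t)\<bar> = 1"
    using M(2) vdet_move[of "[]" p1 H t] by (simp add: abs_mult power_abs)
  \<comment> \<open>The completing vector gets the sign that makes the determinant 1, a value which
    \<open>pos_conf_extend_along\<close> preserves.\<close>
  define p0 where "p0 = twist (if vdet (H @ p1 # t) = 1 then 0 else 1) p1"
  have "vdet (H @ p0 # t) = 1"
    using p1 by (auto simp: p0_def vdet_twist abs_if split: if_splits)
  then obtain p where p: "pos_conf (Suc (Suc m)) t (H @ (Y @ g) @ [p])" "vdet (H @ p # t) = 1"
    using pos_conf_extend_along[OF Suc.prems(1,2), of p0] by auto
  have cHp: "completable k (H @ p # t)"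
    by (rule completable_unimodular) (use p Suc.prems in auto)
  then have "completable k (p # t)" by (rule completable_mset_mono) simp
  then have "completable k (twist (Suc m) p # t)" by (rule completable_twist)
  \<comment> \<open>Rotated to the front, \<open>p\<close> becomes the target of
    \<open>fill_to_vector\<close>.\<close>
  moreover have "pos_conf (Suc (Suc m)) t (twist (Suc m) p # (H @ Y) @ g)"
    using p(1) pos_conf_rotate1[of "Suc m" t "twist (Suc m) p" "H @ Y @ g"] by simp
  ultimately have "fillable (Suc m) t (twist (Suc m) p) (H @ Y) g"
    using fill_to_vector Suc.prems by blast
  then obtain Z1 where Z1: "pos_conf (Suc (Suc m)) t (twist (Suc m) p # (H @ Y) @ g @ Z1)"
      "unimod_windows (Suc (Suc m)) t (g @ Z1 @ [p])"
    by (auto simp: fillable_def)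
  define X where "X = H @ Y @ g @ Z1"
  have posX: "pos_conf (Suc (Suc m)) t (X @ [p])"
    using Z1(1) pos_conf_rotate1[of "Suc m" t "twist (Suc m) p" X] by (simp add: X_def)
  obtain A g' where Ag': "g @ Z1 @ [p] = A @ g'" "length g' = Suc m" "completable k (g' @ t)"
    using completable_window_suffix[OF Z1(2)] Suc.prems by auto
  then obtain g2 where g2: "g' = g2 @ [p]" "length g2 = m" "g @ Z1 = A @ g2"
    by (cases g' rule: rev_cases) auto
  obtain H' h where H: "H = H' @ [h]" "length H' = m"
    using Suc.prems(2) by (cases H rule: rev_cases) auto
  have X_eq: "X = H' @ (h # Y @ A) @ g2" using g2 by (simp add: X_def H)
  have "completable k (H' @ p # t)"
    using cHp by (rule completable_mset_mono) (simp add: H)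
  then obtain Z where Z: "pos_conf (Suc m) (p # t) (X @ Z)"
      "unimod_windows (Suc m) (p # t) (g2 @ Z @ map (twist m) H')"
    using Suc.IH[of "p # t" H' "h # Y @ A" g2] pos_conf_quotient[OF posX] Ag' g2 H Suc.prems(4)
    by (auto simp: X_eq)
  have "vdet (map (twist m) H @ p # t) = 1"
    using vdet_map_twist[of "[]" m H "p # t"] Suc.prems(2) p(2) by simp
  then have "unimod_windows (Suc m) (p # t) (map (twist m) H' @ [twist m h])"
    using H by (simp add: unimod_windows_def)
  then have "unimod_windows (Suc m) (p # t) ((g2 @ Z) @ map (twist m) H' @ [twist m h])"
    by (rule unimod_windows_glue[rotated]) (use Z(2) H in auto)
  then have uni: "unimod_windows (Suc m) (p # t) (g2 @ Z @ map (twist m) H)"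
    by (simp add: H)
  obtain Q where Q: "pos_conf (Suc (Suc m)) t (X @ p # Q)"
      "unimod_windows (Suc (Suc m)) t (g2 @ p # Q @ map (twist (Suc m)) H)"
    using lift_windows[OF posX Z(1) _ _ _ _ uni, of "Y @ g @ Z1"] Suc.prems(2) g2(2)
    by (auto simp: X_def)
  have "unimod_windows (Suc (Suc m)) t (A @ (g2 @ [p]) @ Q @ map (twist (Suc m)) H)"
    by (rule unimod_windows_glue) (use Z1(2) Q(2) Ag' g2 in auto)
  then have "unimod_windows (Suc (Suc m)) t ((g @ Z1) @ p # Q @ map (twist (Suc m)) H)"
    by (simp add: g2(3))
  then show ?case
    using Q(1) by (intro exI[of _ "Z1 @ p # Q"]) (simp add: X_def)
qed

section \<open>Cyclic refinements\<close>

lemma vdet_unit_vectors: "vdet (map (\<lambda>j i. if i = j then 1 else 0) [0..<k]) = 1"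
proof -
  let ?E = "map (\<lambda>j i. if i = j then 1 else 0) [0..<k] :: (nat \<Rightarrow> int) list"
  have "mat k k (\<lambda>(i, j). (?E ! j) i) = 1\<^sub>m k" by (rule eq_matI) auto
  then show ?thesis by (simp add: vdet_def)
qed

lemma completable_Nil: "completable k []"
  by (rule completable_mset_mono[OF completable_unimodular,
        of "map (\<lambda>j i. if i = j then 1 else 0) [0..<k]"])
    (simp_all add: vdet_unit_vectors)

text \<open>Modulo the empty list \<open>x\<close> is \<open>d\<close> times a primitive vector.
  Expanding \<open>x\<close> in the unit vectors shows that \<open>d\<close> divides all its
  coordinates.\<close>

lemma completable_primitive:
  fixes x :: "nat \<Rightarrow> int"
  assumes gcd: "Gcd {x j | j. j < k} = 1"
  shows "completable k [x]"
proof -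
  have "k \<noteq> 0" using gcd by (intro notI) simp
  then obtain u d where u: "completable k [u]"
    and d: "\<And>A B. length A + length B + 1 = k \<Longrightarrow> vdet (A @ x # B) = d * vdet (A @ u # B)"
    using primitive_part[OF completable_Nil, of k x] by auto
  have "d dvd x i" if i: "i < k" for i
  proof -
    define E where "E = map (\<lambda>j i. if i = j then 1 else 0 :: int) [0..<k]"
    have "vdet E = 1" unfolding E_def by (rule vdet_unit_vectors)
    then have "x i = (\<Sum>j<k. vdet (E[j := x]) * (E ! j) i)"
      using vdet_cramer_coord[of i E x] i by (simp add: E_def)
    also have "d dvd \<dots>"
    proof (intro dvd_sum dvd_mult2)
      fix j assume "j \<in> {..<k}"
      then have j: "j < length E" by (simp add: E_def)
      then show "d dvd vdet (E[j := x])"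
        unfolding upd_conv_take_nth_drop[OF j]
        by (subst d) (auto simp: E_def)
    qed
    finally show ?thesis .
  qed
  then have "d dvd Gcd {x j | j. j < k}" by (intro Gcd_greatest) auto
  then have "\<bar>d\<bar> = 1" using gcd by simp
  moreover obtain M where M: "length (M @ [u]) = k" "\<bar>vdet (M @ [u])\<bar> = 1"
    using u by (auto simp: completable_def)
  ultimately have "\<bar>vdet (M @ [x])\<bar> = 1" using d[of M "[]"] by (simp add: abs_mult)
  with M show ?thesis unfolding completable_def by (intro exI[of _ M]) simp
qed

text \<open>Each round fills the gap between the end of \<open>L\<close> and the first vector
  \<open>b\<close> of \<open>B\<close>, then rotates \<open>b\<close> to the end, where it enters
  the chain as \<open>twist m b\<close>.\<close>

lemma fill_to_vectors:
  assumes "pos_conf (Suc m) [] (B @ L)" "unimod_windows (Suc m) [] L" "Suc m \<le> length L"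
    "\<And>b. b \<in> set B \<Longrightarrow> completable (Suc m) [b]"
  shows "\<exists>P. pos_conf (Suc m) [] (L @ P) \<and> unimod_windows (Suc m) [] (L @ P)
      \<and> subseq (map (twist m) B) P"
  using assms
proof (induction B arbitrary: L)
  case Nil
  then show ?case by (intro exI[of _ "[]"]) simp
next
  case (Cons b B)
  obtain A g where Ag: "L = A @ g" "length g = m" "completable (Suc m) (g @ [])"
    using completable_window_suffix[OF Cons.prems(2,3), of "Suc m"] by auto
  have "fillable m [] b (B @ A) g"
    by (rule fill_to_vector[where k = "Suc m"]) (use Cons.prems Ag in auto)
  then obtain Z where Z: "pos_conf (Suc m) [] (b # B @ L @ Z)"
      "unimod_windows (Suc m) [] (g @ Z @ [twist m b])"
    by (auto simp: fillable_def Ag)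
  define L' where "L' = L @ Z @ [twist m b]"
  have "unimod_windows (Suc m) [] (A @ g @ Z @ [twist m b])"
    by (rule unimod_windows_glue) (use Cons.prems(2) Z(2) Ag in auto)
  then have "unimod_windows (Suc m) [] L'" by (simp add: L'_def Ag)
  moreover have "pos_conf (Suc m) [] (B @ L')"
    using Z(1) pos_conf_rotate1[of m "[]" b "B @ L @ Z"] by (simp add: L'_def)
  ultimately obtain P where P: "pos_conf (Suc m) [] (L' @ P)" "unimod_windows (Suc m) [] (L' @ P)"
      "subseq (map (twist m) B) P"
    using Cons.IH[of L'] Cons.prems(3,4) by (auto simp: L'_def)
  have "subseq (map (twist m) (b # B)) (Z @ twist m b # P)"
    using subseq_Cons2[OF P(3), of "twist m b"] by (simp add: subseq_drop_many)
  with P show ?case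
    by (intro exI[of _ "Z @ twist m b # P"]) (simp add: L'_def)
qed

text \<open>A determinant of \<open>m + 1\<close> twisted vectors changes by the sign with exponent
  \<open>m * (m + 1)\<close>, which is even.\<close>

lemma pos_conf_map_twist:
  assumes "pos_conf (Suc m) [] X"
  shows "pos_conf (Suc m) [] (map (twist m) X)"
  unfolding pos_conf_def
proof (intro allI impI)
  fix J assume J: "subseq J (map (twist m) X)" "length J = Suc m"
  from subseq_map[OF J(1), of "twist m"] have "subseq (map (twist m) J) X"
    by (simp add: comp_def)
  then have "0 < vdet (map (twist m) J @ [])"
    using assms J by (simp add: pos_conf_def)
  then show "0 < vdet (J @ [])"
    using vdet_map_twist[of "[]" m J "[]"] J(2) by simp
qed

lemma unimod_windows_map_twist:
  assumes "unimod_windows (Suc m) [] X"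
  shows "unimod_windows (Suc m) [] (map (twist m) X)"
  unfolding unimod_windows_def
proof (intro allI impI)
  fix i assume i: "i + Suc m \<le> length (map (twist m) X)"
  have "vdet (map (twist m) (take (Suc m) (drop i X))) = vdet (take (Suc m) (drop i X))"
    using vdet_map_twist[of "[]" m "take (Suc m) (drop i X)" "[]"] i by simp
  with assms i show "vdet (take (Suc m) (drop i (map (twist m) X)) @ []) = 1"
    by (simp add: unimod_windows_def take_map drop_map)
qed

text \<open>The basis \<open>Y\<close> after \<open>X\<close> starts a unimodular chain, which is
  led through the vectors of \<open>X\<close> one turn later and closed up in the first
  \<open>m\<close> vectors of \<open>Y\<close>.\<close>

lemma cyclic_unimodular_refinement:
  assumes pos: "pos_conf (Suc m) [] X" and len: "Suc m \<le> length X"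
    and prim: "\<And>x. x \<in> set X \<Longrightarrow> completable (Suc m) [x]"
  obtains L where "subseq X L" "pos_conf (Suc m) [] L"
    "unimod_windows (Suc m) [] (L @ map (twist m) (take m L))"
proof -
  obtain Y where Y: "length Y = Suc m" "pos_conf (Suc m) [] (X @ Y)" "vdet Y = 1"
    using pos_conf_extend_basis[OF pos len completable_Nil, of "Suc m"] by auto
  have "unimod_windows (Suc m) [] Y" using Y by (simp add: unimod_windows_def)
  then obtain P where P: "pos_conf (Suc m) [] (Y @ P)" "unimod_windows (Suc m) [] (Y @ P)"
      "subseq (map (twist m) X) P"
    using fill_to_vectors[of m X Y] Y prim by auto
  have lenP: "Suc m \<le> length P" using list_emb_length[OF P(3)] len by simp
  obtain A g where Ag: "Y @ P = A @ g" "length g = m" "completable (Suc m) (g @ [])"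
    using completable_window_suffix[OF P(2), of "Suc m"] Y by auto
  define H where "H = take m Y"
  have "length A = Suc (length P)" using arg_cong[OF Ag(1), of length] Ag(2) Y(1) by simp
  then have "take m A = H"
    using arg_cong[OF Ag(1), of "take m"] lenP Y(1) by (simp add: H_def)
  then have A: "A = H @ drop m A" using append_take_drop_id[of m A] by simp
  have "completable (Suc m) Y" by (rule completable_unimodular) (use Y in auto)
  then have cH: "completable (Suc m) (H @ [])"
    by (rule completable_mset_mono)
      (subst append_take_drop_id[of m Y, symmetric], simp add: H_def del: append_take_drop_id)
  have posA: "pos_conf (Suc m) [] (H @ drop m A @ g)"
    using P(1) unfolding Ag(1) by (subst (asm) A) simp
  have "length H = m" "length [] + Suc m = Suc m" using Y(1) by (simp_all add: H_def)
  from fill_to_flag[OF posA this(1) Ag(2) this(2) cH Ag(3)]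
  obtain Z where Z: "pos_conf (Suc m) [] (H @ drop m A @ g @ Z)"
      "unimod_windows (Suc m) [] (g @ Z @ map (twist m) H)"
    by blast
  define L where "L = Y @ P @ Z"
  have "L = (Y @ P) @ Z" by (simp add: L_def)
  then have L: "L = A @ g @ Z" unfolding Ag(1) by simp
  have "pos_conf (Suc m) [] L" unfolding L by (subst A) (use Z(1) in simp)
  moreover have "unimod_windows (Suc m) [] (A @ g @ Z @ map (twist m) H)"
    by (rule unimod_windows_glue) (use P(2) Z(2) Ag in auto)
  then have "unimod_windows (Suc m) [] (L @ map (twist m) H)" by (simp add: L)
  moreover have "take m L = H" using Y(1) by (simp add: L_def H_def)
  \<comment> \<open>The chain contains \<open>X\<close> in twisted form; twisting all of it restores
    \<open>X\<close> and preserves positivity and windows.\<close>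
  ultimately have *: "pos_conf (Suc m) [] (map (twist m) L)"
      "unimod_windows (Suc m) [] (map (twist m) L @ map (twist m) (take m (map (twist m) L)))"
    using pos_conf_map_twist[of m L] unimod_windows_map_twist[of m "L @ map (twist m) H"]
    by (auto simp: take_map)
  have "subseq (map (twist m) X) L"
    using P(3) by (simp add: L_def subseq_drop_many subseq_rev_drop_many)
  from subseq_map[OF this, of "twist m"] have "subseq X (map (twist m) L)"
    by (simp add: comp_def)
  with * that show ?thesis by blast
qed

section \<open>Translation to indexed families and cyclic windows\<close>

lemma subseq_embedding:
  "subseq xs ys \<Longrightarrow> \<exists>h. strict_mono_on {..<length xs} h
      \<and> (\<forall>i<length xs. h i < length ys \<and> ys ! h i = xs ! i)"
proof (induction xs ys rule: list_emb.induct)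
  case (list_emb_Nil ys)
  then show ?case by (auto simp: strict_mono_on_def)
next
  case (list_emb_Cons xs ys y)
  then obtain h where "strict_mono_on {..<length xs} h"
    "\<forall>i<length xs. h i < length ys \<and> ys ! h i = xs ! i" by blast
  then show ?case by (intro exI[of _ "Suc \<circ> h"]) (auto simp: strict_mono_on_def)
next
  case (list_emb_Cons2 x y xs ys)
  then obtain h where h: "strict_mono_on {..<length xs} h"
    "\<forall>i<length xs. h i < length ys \<and> ys ! h i = xs ! i" by blast
  then show ?case using \<open>x = y\<close>
    by (intro exI[of _ "\<lambda>i. case i of 0 \<Rightarrow> 0 | Suc j \<Rightarrow> Suc (h j)"])
      (auto simp: strict_mono_on_def nth_Cons split: nat.split)
qed

lemma col_det_eq_vdet:
  assumes "length js = k" "\<And>i j. i \<in> set js \<Longrightarrow> j < k \<Longrightarrow> v i $ j = f i j"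
  shows "col_det k v js = vdet (map f js)"
  unfolding col_det_def vdet_def
  by (rule arg_cong[of _ _ det], rule eq_matI) (auto simp: mat_of_cols_def assms)

lemma subseq_incr_seqs:
  assumes "subseq J (map f [1..<Suc n])"
  obtains js where "J = map f js" "js \<in> incr_seqs (length J) n"
proof -
  obtain N where N: "J = nths (map f [1..<Suc n]) N" using assms subseq_conv_nths by blast
  define js where "js = nths [1..<Suc n] N"
  have J: "J = map f js" using N by (simp add: js_def nths_map)
  moreover have "sorted js" "distinct js" "set js \<subseteq> {1..n}"
    using set_nths_subset[of "[1..<Suc n]" N] by (auto simp: js_def sorted_nths simp del: upt_Suc)
  ultimately have "js \<in> incr_seqs (length J) n"
    by (simp add: incr_seqs_def strict_sorted_iff)
  with J that show ?thesis by blast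
qed

lemma incr_seqs_subseq:
  assumes "js \<in> incr_seqs k (length L)"
  shows "subseq (map (\<lambda>i. L ! (i - 1)) js) L"
proof -
  have js: "sorted_wrt (<) js" "set js \<subseteq> set [1..<Suc (length L)]"
    using assms by (auto simp: incr_seqs_def)
  have "subseq js [1..<Suc (length L)]"
    using js by (intro sorted_subset_imp_subseq) (auto simp: strict_sorted_iff simp del: upt_Suc)
  then have "subseq (map (\<lambda>i. L ! (i - 1)) js) (map (\<lambda>i. L ! (i - 1)) [1..<Suc (length L)])"
    by (rule subseq_map)
  moreover have "map (\<lambda>i. L ! (i - 1)) [1..<Suc (length L)] = L"
    by (rule nth_equalityI) (auto simp del: upt_Suc)
  ultimately show ?thesis by simp
qed

text \<open>The twisted vectors at the end of a linear window return to the front, where sorting the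
  reduced indices puts them.\<close>

lemma vdet_append_twist:
  "length A + length B = Suc m \<Longrightarrow> vdet (A @ map (twist m) B) = vdet (B @ A)"
proof (induction B arbitrary: A)
  case (Cons b B)
  then show ?case
    using Cons.IH[of "A @ [twist m b]"] vdet_rotate[of "B @ A" b "[]"]
    by (simp add: add.commute)
qed simp

lemma reduce_index_eq: "1 \<le> j \<Longrightarrow> j \<le> l \<Longrightarrow> reduce_index l j = j"
  by (simp add: reduce_index_def)

lemma reduce_index_wrap: "1 \<le> j \<Longrightarrow> j \<le> l \<Longrightarrow> reduce_index l (l + j) = j"
  by (cases j) (simp_all add: reduce_index_def)

lemma vdet_cyclic_window:
  assumes uni: "unimod_windows (Suc m) [] (L @ map (twist m) (take m L))"
    and i: "1 \<le> i" "i \<le> length L" and m: "Suc m \<le> length L"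
  shows "vdet (map (\<lambda>j. L ! (j - 1)) (cyclic_window (Suc m) (length L) i)) = 1"
proof -
  let ?l = "length L" and ?f = "\<lambda>j. L ! (j - 1)"
  have uni_i: "vdet (take (Suc m) (drop (i - 1) (L @ map (twist m) (take m L)))) = 1"
    using uni i m by (simp add: unimod_windows_def del: drop_append take_append)
  show ?thesis
  proof (cases "i + m \<le> ?l")
    case True
    have "map (reduce_index ?l) [i..<i + Suc m] = [i..<i + Suc m]"
      by (rule map_idI) (use True i in \<open>auto intro!: reduce_index_eq\<close>)
    then have "cyclic_window (Suc m) ?l i = [i..<i + Suc m]"
      by (simp add: cyclic_window_def sorted_sort_id del: upt_Suc)
    moreover have "map ?f [i..<i + Suc m] = take (Suc m) (drop (i - 1) (L @ map (twist m) (take m L)))"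
      by (rule nth_equalityI) (use True i in \<open>auto simp: nth_append simp del: upt_Suc drop_append take_append\<close>)
    ultimately show ?thesis using uni_i by simp
  next
    case False
    \<comment> \<open>\<open>r\<close> of the indices exceed the length and wrap around to
      \<open>1\<close>, ..., \<open>r\<close>. As \<open>Suc m\<close> is at most the length,
      \<open>r < i\<close>, so sorting puts them before \<open>i\<close>.\<close>
    define r where "r = i + m - ?l"
    have r: "i + m = ?l + r" "1 \<le> r" "r \<le> m" "r < i" using False i m by (auto simp: r_def)
    have "[i..<i + Suc m] = [i..<Suc ?l] @ map ((+) ?l) [1..<Suc r]"
      by (rule nth_equalityI) (use r i in \<open>auto simp: nth_append simp del: upt_Suc\<close>)
    then have "map (reduce_index ?l) [i..<i + Suc m] = [i..<Suc ?l] @ [1..<Suc r]"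
      using i r by (auto simp: reduce_index_eq reduce_index_wrap simp del: upt_Suc intro!: map_idI)
    then have "cyclic_window (Suc m) ?l i = [1..<Suc r] @ [i..<Suc ?l]"
      unfolding cyclic_window_def
      by (intro properties_for_sort) (use r in \<open>auto simp: sorted_append simp del: upt_Suc\<close>)
    moreover have "map ?f [1..<Suc r] = take r L"
      by (rule nth_equalityI) (use r i in \<open>auto simp del: upt_Suc\<close>)
    moreover have "map ?f [i..<Suc ?l] = drop (i - 1) L"
      by (rule nth_equalityI) (use i in \<open>auto simp del: upt_Suc\<close>)
    moreover have "take (Suc m) (drop (i - 1) (L @ map (twist m) (take m L)))
        = drop (i - 1) L @ map (twist m) (take r L)"
    proof -
      have "m + i - ?l = r" using r(1) by simp
      then show ?thesis using r i by (auto simp: take_map min_def)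
    qed
    moreover have "vdet (drop (i - 1) L @ map (twist m) (take r L)) = vdet (take r L @ drop (i - 1) L)"
      by (rule vdet_append_twist) (use r i in auto)
    ultimately show ?thesis using uni_i by (simp del: upt_Suc)
  qed
qed

theorem theorem7p1:
  fixes k n :: nat and x :: "nat \<Rightarrow> int vec"
  assumes "k \<le> n"
    and "\<And>i. i \<in> {1..n} \<Longrightarrow> x i \<in> carrier_vec k"
    and "\<And>i. i \<in> {1..n} \<Longrightarrow> Gcd {x i $ j | j. j < k} = 1"
    and "\<And>js. js \<in> incr_seqs k n \<Longrightarrow> col_det k x js > 0"
  shows "\<exists>(l::nat) (y :: nat \<Rightarrow> int vec) (s :: nat \<Rightarrow> nat).
           n \<le> l \<and>
           (\<forall>i\<in>{1..l}. y i \<in> carrier_vec k) \<and>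
           (\<forall>r\<in>{1..n}. s r \<in> {1..l}) \<and> strict_mono_on {1..n} s \<and>
           (\<forall>r\<in>{1..n}. y (s r) = x r) \<and>
           (\<forall>js\<in>incr_seqs k l. col_det k y js > 0) \<and>
           (\<forall>i\<in>{1..l}. col_det k y (cyclic_window k l i) = 1)"
proof (cases k)
  case 0
  \<comment> \<open>The \<open>Gcd\<close> of no coordinates is 0, so there are no vectors at all
    and the empty family is the answer.\<close>
  have "n = 0"
  proof (rule ccontr)
    assume "n \<noteq> 0"
    then show False using assms(3)[of 1] 0 by simp
  qed
  then show ?thesis
    using assms(4) by (intro exI[of _ 0] exI[of _ x] exI[of _ id]) (auto simp: strict_mono_on_def)
next
  case (Suc m)
  define f where "f i = (\<lambda>j. x i $ j)" for i
  define X where "X = map f [1..<Suc n]"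
  have pos: "pos_conf (Suc m) [] X"
    unfolding pos_conf_def
  proof (intro allI impI)
    fix J assume J: "subseq J X" "length J = Suc m"
    then obtain js where js: "J = map f js" "js \<in> incr_seqs k n"
      using subseq_incr_seqs[of J f n] Suc by (metis X_def)
    then have "col_det k x js = vdet (map f js)"
      by (intro col_det_eq_vdet) (auto simp: incr_seqs_def f_def)
    then show "0 < vdet (J @ [])" using assms(4)[OF js(2)] js(1) by simp
  qed
  have prim: "completable (Suc m) [u]" if "u \<in> set X" for u
  proof -
    from that obtain i where "i \<in> set [1..<Suc n]" "u = f i"
      unfolding X_def set_map by blast
    then have "i \<in> {1..n}" "u = f i" by auto
    then show ?thesis using assms(3)[of i] Suc by (auto simp: f_def intro: completable_primitive)
  qed
  obtain L where L: "subseq X L" "pos_conf (Suc m) [] L"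
      "unimod_windows (Suc m) [] (L @ map (twist m) (take m L))"
    using cyclic_unimodular_refinement[OF pos _ prim] assms(1) Suc by (auto simp: X_def)
  have lenX: "length X = n" by (simp add: X_def)
  have len: "n \<le> length L" using list_emb_length[OF L(1)] lenX by simp
  obtain h where h: "strict_mono_on {..<n} h" "\<And>i. i < n \<Longrightarrow> h i < length L \<and> L ! h i = X ! i"
    using subseq_embedding[OF L(1)] lenX by auto
  \<comment> \<open>Lists count from 0 and families from 1, hence the shift here and in
    \<open>s\<close>.\<close>
  define y where "y i = vec k (L ! (i - 1))" for i
  have col: "col_det k y js = vdet (map (\<lambda>i. L ! (i - 1)) js)" if "length js = k" for js
    by (rule col_det_eq_vdet) (use that in \<open>auto simp: y_def\<close>)
  define s where "s r = Suc (h (r - 1))" for r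
  have "y (s r) = x r" if r: "r \<in> {1..n}" for r
  proof -
    have "L ! h (r - 1) = f r" using h(2)[of "r - 1"] r by (auto simp: X_def simp del: upt_Suc)
    then show ?thesis using assms(2)[OF r] by (intro eq_vecI) (auto simp: y_def s_def f_def)
  qed
  moreover have "strict_mono_on {1..n} s"
    unfolding s_def by (intro strict_mono_onI) (auto intro!: strict_mono_onD[OF h(1)])
  moreover have "s r \<in> {1..length L}" if "r \<in> {1..n}" for r
  proof -
    have "r - 1 < n" using that by auto
    then show ?thesis using h(2)[of "r - 1"] by (simp add: s_def Suc_le_eq)
  qed
  moreover have "col_det k y js > 0" if "js \<in> incr_seqs k (length L)" for js
    using that col[of js] pos_confD[OF L(2) incr_seqs_subseq[OF that]] Suc
    by (simp add: incr_seqs_def)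
  moreover have "col_det k y (cyclic_window k (length L) i) = 1" if "i \<in> {1..length L}" for i
    using col[of "cyclic_window k (length L) i"] vdet_cyclic_window[OF L(3), of i] that Suc assms(1) len
    by (simp add: cyclic_window_def)
  ultimately show ?thesis
    using len by (intro exI[of _ "length L"] exI[of _ y] exI[of _ s]) (auto simp: y_def)
qed

end
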